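(* For a class $\mathbf{C}$ of bounded open subsets of $2^\omega$ and a countable family $(\mathcal{T}^{(e)}_n)_{e,n\in\mathbb{N}}$ of tests, consider the following properties. (P1) For all $\mathcal{U}\in\mathbf{C}$ and $\sigma\in 2^{<\omega}$, if $\mu(\mathcal{U}\mid\sigma)<1$, then there exists $\mathcal{V}\in\mathbf{C}$ such that $(\mathcal{U}\mid\sigma)\subseteq\mathcal{V}$. (P2) For all $\mathcal{U}\in\mathbf{C}$, there exists $\mathcal{V}\in\mathbf{C}$ such that $\mathcal{U}\subseteq\mathcal{V}$ and, for all $\sigma\in 2^{<\omega}$, if $\mu(\mathcal{U}\mid\sigma)=1$ then $[\sigma]\subseteq\mathcal{V}$. (P3) For all $\mathcal{U}\in\mathbf{C}$ and $\sigma\in 2^{<\omega}$, if $\mu(\mathcal{U}\mid\sigma)<1$, then for all $e\in\mathbb{N}$ there exist $n_e\in\mathbb{N}$ and $\mathcal{V}\in\mathbf{C}$ such that $(\mathcal{U}\cup\mathcal{T}^{(e)}_{n_e})\subseteq\mathcal{V}$ and $\mu(\mathcal{V}\mid\sigma)<1$. Then (P1), (P2) and (P3) are all satisfied in each of the following three cases. (MLR) $\mathbf{C}$ is the class of bounded c.e. open sets and $(\mathcal{T}^{(e)})_{e}$ is the family of Martin-Löf tests. (CR) $\mathbf{C}$ is the class of open sets that are winning sets of exactly computable normed martingales and $(\mathcal{T}^{(e)})_{e}$ is the family of tests induced by those martingales. (SR) $\mathbf{C}$ is the class of bounded Schnorr open sets and $(\mathcal{T}^{(e)})_{e}$ is the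 family of Schnorr tests.
   Context: $2^\omega$ is Cantor space, $2^{<\omega}$ the set of finite binary strings, $\epsilon$ the empty string, $\mu$ the uniform measure on $2^\omega$. For a string $\sigma$, $[\sigma]$ is the set of infinite sequences with prefix $\sigma$; for $U\subseteq 2^{<\omega}$, $[U]=\bigcup_{\sigma\in U}[\sigma]$. An open set is bounded if its measure is smaller than $1$. A c.e. open set is a set $[U]$ with $U$ a c.e. prefix-free set of strings; it is a Schnorr (open) set if its measure is a computable real. For $\mathcal{X}\subseteq 2^\omega$, $(\mathcal{X}\mid\sigma)=\{Z\in 2^\omega : \sigma Z\in\mathcal{X}\}$, and $\mu(\mathcal{X}\mid\sigma)$ is its measure. A test is a non-increasing sequence $(\mathcal{U}_n)_{n\in\mathbb{N}}$ of open sets with $\mu(\bigcap_n\mathcal{U}_n)=0$. A Martin-Löf test is a test consisting of uniformly c.e. open sets with $\mu(\mathcal{U}_n)\leq 2^{-n}$ for all $n$; it is a Schnorr test if moreover $\mu(\mathcal{U}_n)=2^{-n}$ for all $n$. A martingale is a function $d:2^{<\omega}\to\mathbb{R}^{\geq 0}$ with $d(\sigma)=\frac{d(\sigma 0)+d(\sigma 1)}{2}$ for all $\sigma$; it is normed if $d(\epsilon)=1$, and exactly computable if it is rational-valued and computable as a function into $\mathbb{Q}^{\geq 0}$. A string is minimal for a property if it satisfies the property and no proper prefix of it does. The $(d,q)$-winning set is $\{\sigma : \sigma\text{ minimal such that } d(\sigma)\geq q\}$; a winning set of strings is a $(d,q)$-winning set for some exactly computable normed martingale $d$ and some rational $q>1$,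 and an open set is a winning set if it equals $[U]$ for some winning set of strings $U$. The test induced by an exactly computable normed martingale $d$ is $(\mathcal{U}_n)_{n\in\mathbb{N}}$ where $\mathcal{U}_n$ is the open set generated by the $(d,2^n)$-winning set. *)

theory Defs
  imports "HOL-Probability.Probability" "HOL-Library.Sublist"
begin

section \<open>Computability\<close>

text \<open>
  The total recursive functions of arity \<open>n\<close>: the least class containing the initial functions and
  closed under composition, primitive recursion and minimization of regular functions. A function of
  arity \<open>n\<close> is applied to argument lists of length \<open>n\<close>; its values on other lists are junk.
\<close>

inductive recursive :: "nat \<Rightarrow> (nat list \<Rightarrow> nat) \<Rightarrow> bool" where
  zero: "recursive n (\<lambda>xs. 0)"
| succ: "recursive 1 (\<lambda>xs. Suc (xs ! 0))"
| proj: "i < n \<Longrightarrow> recursive n (\<lambda>xs. xs ! i)"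
| comp: "recursive (length gs) f \<Longrightarrow> (\<And>g. g \<in> set gs \<Longrightarrow> recursive n g) \<Longrightarrow>
    recursive n (\<lambda>xs. f (map (\<lambda>g. g xs) gs))"
| prim_rec: "recursive n f \<Longrightarrow> recursive (Suc (Suc n)) g \<Longrightarrow>
    recursive (Suc n) (\<lambda>xs. rec_nat (f (tl xs)) (\<lambda>k r. g (k # r # tl xs)) (hd xs))"
| minim: "recursive (Suc n) f \<Longrightarrow> (\<And>xs. length xs = n \<Longrightarrow> \<exists>y. f (y # xs) = 0) \<Longrightarrow>
    recursive n (\<lambda>xs. LEAST y. f (y # xs) = 0)"

text \<open>The length-lexicographic bijection between binary strings and natural numbers.\<close>

definition str_code :: "bool list \<Rightarrow> nat" where
  "str_code \<sigma> = foldl (\<lambda>n b. 2 * n + (if b then 2 else 1)) 0 \<sigma>"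

text \<open>
  Enumeration in stages: stage \<open>s\<close> enumerates the string with code \<open>x\<close> if the value is \<open>Suc x\<close>, and
  nothing if the value is \<open>0\<close>, so that the empty set needs no separate treatment.
\<close>

definition ce_strings :: "bool list set \<Rightarrow> bool" where
  "ce_strings U \<longleftrightarrow> (\<exists>f. recursive 1 f \<and> U = {\<sigma>. \<exists>s. f [s] = Suc (str_code \<sigma>)})"

definition uniformly_ce_strings :: "(nat \<Rightarrow> bool list set) \<Rightarrow> bool" where
  "uniformly_ce_strings U \<longleftrightarrow>
    (\<exists>f. recursive 2 f \<and> (\<forall>n. U n = {\<sigma>. \<exists>s. f [n, s] = Suc (str_code \<sigma>)}))"

definition computable_real :: "real \<Rightarrow> bool" where
  "computable_real x \<longleftrightarrow>
    (\<exists>a b c. recursive 1 a \<and> recursive 1 b \<and> recursive 1 c \<and>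
      (\<forall>n. \<bar>x - (real (a [n]) - real (b [n])) / real (Suc (c [n]))\<bar> \<le> 1 / 2 ^ n))"


section \<open>Cantor space\<close>

text \<open>\<open>nat \<Rightarrow> bool\<close> carries the product topology of the discrete topology on \<open>bool\<close>.\<close>

type_synonym cantor = "nat \<Rightarrow> bool"

definition \<mu> :: "cantor measure" where
  "\<mu> = (\<Pi>\<^sub>M i\<in>UNIV. uniform_count_measure (UNIV :: bool set))"

definition append_seq :: "bool list \<Rightarrow> cantor \<Rightarrow> cantor" where
  "append_seq \<sigma> Z = (\<lambda>n. if n < length \<sigma> then \<sigma> ! n else Z (n - length \<sigma>))"

definition cylinder :: "bool list \<Rightarrow> cantor set" where
  "cylinder \<sigma> = {Z. \<forall>i<length \<sigma>. Z i = \<sigma> ! i}"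

definition generated :: "bool list set \<Rightarrow> cantor set" where
  "generated U = (\<Union>\<sigma>\<in>U. cylinder \<sigma>)"

text \<open>The set \<open>(X | \<sigma>)\<close>.\<close>

definition above :: "cantor set \<Rightarrow> bool list \<Rightarrow> cantor set" where
  "above X \<sigma> = {Z. append_seq \<sigma> Z \<in> X}"

definition prefix_free :: "bool list set \<Rightarrow> bool" where
  "prefix_free U \<longleftrightarrow> (\<forall>\<sigma>\<in>U. \<forall>\<tau>\<in>U. \<not> strict_prefix \<sigma> \<tau>)"

definition bounded_open :: "cantor set \<Rightarrow> bool" where
  "bounded_open U \<longleftrightarrow> open U \<and> measure \<mu> U < 1"

definition ce_open :: "cantor set \<Rightarrow> bool" where
  "ce_open X \<longleftrightarrow> (\<exists>U. ce_strings U \<and> prefix_free U \<and> X = generated U)"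

definition uniformly_ce_open :: "(nat \<Rightarrow> cantor set) \<Rightarrow> bool" where
  "uniformly_ce_open X \<longleftrightarrow>
    (\<exists>U. uniformly_ce_strings U \<and> (\<forall>n. prefix_free (U n) \<and> X n = generated (U n)))"

definition schnorr_open :: "cantor set \<Rightarrow> bool" where
  "schnorr_open X \<longleftrightarrow> ce_open X \<and> computable_real (measure \<mu> X)"


section \<open>Tests\<close>

definition test :: "(nat \<Rightarrow> cantor set) \<Rightarrow> bool" where
  "test T \<longleftrightarrow> decseq T \<and> (\<forall>n. open (T n)) \<and> measure \<mu> (\<Inter>n. T n) = 0"

definition martin_loef_test :: "(nat \<Rightarrow> cantor set) \<Rightarrow> bool" where
  "martin_loef_test T \<longleftrightarrow>
    test T \<and> uniformly_ce_open T \<and> (\<forall>n. measure \<mu> (T n) \<le> 1 / 2 ^ n)"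

definition schnorr_test :: "(nat \<Rightarrow> cantor set) \<Rightarrow> bool" where
  "schnorr_test T \<longleftrightarrow> martin_loef_test T \<and> (\<forall>n. measure \<mu> (T n) = 1 / 2 ^ n)"


section \<open>Martingales\<close>

definition martingale :: "(bool list \<Rightarrow> real) \<Rightarrow> bool" where
  "martingale d \<longleftrightarrow>
    (\<forall>\<sigma>. 0 \<le> d \<sigma>) \<and> (\<forall>\<sigma>. d \<sigma> = (d (\<sigma> @ [False]) + d (\<sigma> @ [True])) / 2)"

definition normed :: "(bool list \<Rightarrow> real) \<Rightarrow> bool" where
  "normed d \<longleftrightarrow> d [] = 1"

definition exactly_computable :: "(bool list \<Rightarrow> real) \<Rightarrow> bool" where
  "exactly_computable d \<longleftrightarrow>
    (\<exists>a c. recursive 1 a \<and> recursive 1 c \<and>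
      (\<forall>\<sigma>. d \<sigma> = real (a [str_code \<sigma>]) / real (Suc (c [str_code \<sigma>]))))"

definition ecn_martingale :: "(bool list \<Rightarrow> real) \<Rightarrow> bool" where
  "ecn_martingale d \<longleftrightarrow> martingale d \<and> normed d \<and> exactly_computable d"

definition minimal_strings :: "(bool list \<Rightarrow> bool) \<Rightarrow> bool list set" where
  "minimal_strings P = {\<sigma>. P \<sigma> \<and> (\<forall>\<tau>. strict_prefix \<tau> \<sigma> \<longrightarrow> \<not> P \<tau>)}"

definition winning_set_of :: "(bool list \<Rightarrow> real) \<Rightarrow> real \<Rightarrow> bool list set" where
  "winning_set_of d q = minimal_strings (\<lambda>\<sigma>. d \<sigma> \<ge> q)"

definition winning_strings :: "bool list set \<Rightarrow> bool" where
  "winning_strings U \<longleftrightarrow> (\<exists>d q. ecn_martingale d \<and> q \<in> \<rat> \<and> q > 1 \<and> U = winning_set_of d q)"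

definition winning_open :: "cantor set \<Rightarrow> bool" where
  "winning_open X \<longleftrightarrow> (\<exists>U. winning_strings U \<and> X = generated U)"

definition induced_test :: "(bool list \<Rightarrow> real) \<Rightarrow> nat \<Rightarrow> cantor set" where
  "induced_test d n = generated (winning_set_of d (2 ^ n))"


section \<open>The three properties\<close>

definition P1 :: "cantor set set \<Rightarrow> bool" where
  "P1 C \<longleftrightarrow>
    (\<forall>U\<in>C. \<forall>\<sigma>. measure \<mu> (above U \<sigma>) < 1 \<longrightarrow> (\<exists>V\<in>C. above U \<sigma> \<subseteq> V))"

definition P2 :: "cantor set set \<Rightarrow> bool" where
  "P2 C \<longleftrightarrow>
    (\<forall>U\<in>C. \<exists>V\<in>C. U \<subseteq> V \<and> (\<forall>\<sigma>. measure \<mu> (above U \<sigma>) = 1 \<longrightarrow> cylinder \<sigma> \<subseteq> V))"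

definition P3 :: "cantor set set \<Rightarrow> (nat \<Rightarrow> nat \<Rightarrow> cantor set) \<Rightarrow> bool" where
  "P3 C T \<longleftrightarrow>
    (\<forall>U\<in>C. \<forall>\<sigma>. measure \<mu> (above U \<sigma>) < 1 \<longrightarrow>
      (\<forall>e. \<exists>n. \<exists>V\<in>C. U \<union> T e n \<subseteq> V \<and> measure \<mu> (above V \<sigma>) < 1))"

text \<open>
  The properties are formulated for a class \<open>C\<close> of bounded open sets and a countable family of
  tests. Here \<open>F\<close> is the set of members of the family; that it can be listed as
  \<open>T 0, T 1, \<dots>\<close> is part of the claim, and (P3) is required of every such listing.
\<close>

definition satisfies_P1_P2_P3 :: "cantor set set \<Rightarrow> (nat \<Rightarrow> cantor set) set \<Rightarrow> bool" where
  "satisfies_P1_P2_P3 C F \<longleftrightarrow>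
    (\<forall>U\<in>C. bounded_open U) \<and> (\<forall>t\<in>F. test t) \<and> (\<exists>T :: nat \<Rightarrow> _. range T = F) \<and>
    P1 C \<and> P2 C \<and> (\<forall>T. range T = F \<longrightarrow> P3 C T)"

end

theory Submission
  imports Defs "HOL-Library.Nat_Bijection" "HOL-Library.Countable"
begin

text \<open>
  Every open set in question has the form \<open>hits P\<close>: the sequences that have some prefix with the
  property \<open>P\<close>. A set is c.e. open exactly if \<open>P\<close> can be chosen computable, and \<open>P\<close> may then be assumed
  to be inherited by extensions (\<open>ce_openE\<close>, \<open>ce_open_hits\<close>). So the set is the increasing union of the
  clopen sets \<open>stage P n\<close>, in which \<open>P\<close> is tested on prefixes of length \<open>n\<close> only, and whose measures,
  globally and inside any cylinder, are found by counting strings. It is Schnorr open if and only if,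
  in addition, some computable \<open>N\<close> makes the part still missing from \<open>stage P (N k)\<close> of measure at most
  \<open>1 / 2 ^ k\<close> (\<open>schnorr_openI\<close>, \<open>schnorr_openE\<close>). The other tool is Ville's inequality: a martingale \<open>d\<close>
  reaches \<open>q\<close> with probability at most \<open>d [] / q\<close>.

  For c.e. and Schnorr open sets, (P1) holds with \<open>(U | \<sigma>)\<close> itself, and (P3) holds with
  \<open>U \<union> T n\<close> for large \<open>n\<close>, because passing to \<open>(\<cdot> | \<sigma>)\<close> multiplies the measure of \<open>T n\<close> by at most
  the constant \<open>2 ^ length \<sigma>\<close>. The substance is (P2).

  For a c.e. open \<open>U\<close>, choose a rational \<open>q\<close> with \<open>\<mu> U < q < 1\<close> and let \<open>V\<close> be generated by the strings \<open>\<sigma>\<close>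
  with \<open>\<mu> (U | \<sigma>) > q\<close>. This is a c.e. condition, and since \<open>\<sigma> \<mapsto> \<mu> (U | \<sigma>)\<close> is a martingale, Ville's
  inequality gives \<open>\<mu> V \<le> \<mu> U / q < 1\<close> (\<open>ce_superset_of_density_points\<close>).

  This \<open>V\<close> need not have a computable measure. For a Schnorr open \<open>U\<close>, the values \<open>\<mu> (U | \<sigma>)\<close> are
  computable, so one can instead decide, for each \<open>\<sigma>\<close>, whether an approximation from below of \<open>\<mu> (U | \<sigma>)\<close>
  with error \<open>1 / 2 ^ (length \<sigma> + c)\<close> comes within that error of \<open>1\<close>, and collect the strings for which it does. Strings of
  length \<open>n\<close> then contribute at most \<open>1 / 2 ^ (n + c)\<close> outside \<open>U\<close>: the total is small, and the tails of this geometric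
  series supply the required modulus (\<open>schnorr_superset_of_density_points\<close>).

  For a winning set, given by \<open>d\<close> and \<open>q\<close>, (P1) holds by rescaling \<open>d\<close> above \<open>\<sigma>\<close>, and (P2) holds with
  \<open>V = U\<close>, since by Ville's inequality \<open>\<mu> (U | \<sigma>) = 1\<close> forces \<open>d\<close> to have reached \<open>q\<close> already. For (P3) and
  a test induced by \<open>e\<close>, the martingale \<open>(1 - 1/K) d + (1/K) e\<close> with target \<open>(1 - 1/K) q\<close> wins wherever \<open>d\<close>
  reaches \<open>q\<close> or \<open>e\<close> reaches a large enough power of two; for large \<open>K\<close> it is still below its target along \<open>\<sigma>\<close>.
\<close>


section \<open>Recursive functions on tuples\<close>

text \<open>
  The values of a recursive function on lists of the wrong length are an accident of its derivation,
  so \<open>recursive n\<close> is not closed under functions that agree on all lists of length \<open>n\<close>. This closure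
  is what lets functions be given by convenient terms.
\<close>

definition recursive_on :: "nat \<Rightarrow> (nat list \<Rightarrow> nat) \<Rightarrow> bool" where
  "recursive_on n f \<longleftrightarrow> (\<exists>F. recursive n F \<and> (\<forall>xs. length xs = n \<longrightarrow> F xs = f xs))"

lemma recursive_onI: "recursive n f \<Longrightarrow> recursive_on n f"
  by (auto simp: recursive_on_def)

lemma recursive_on_cong:
  "recursive_on n f \<Longrightarrow> (\<And>xs. length xs = n \<Longrightarrow> f xs = g xs) \<Longrightarrow> recursive_on n g"
  unfolding recursive_on_def by metis

lemma recursive_on_comp1:
  assumes "recursive_on 1 f" "recursive_on n g"
  shows "recursive_on n (\<lambda>xs. f [g xs])"
proof -
  obtain F G where "recursive 1 F" "recursive n G"
    and eq: "\<forall>xs. length xs = 1 \<longrightarrow> F xs = f xs" "\<forall>xs. length xs = n \<longrightarrow> G xs = g xs"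
    using assms unfolding recursive_on_def by metis
  then have "recursive n (\<lambda>xs. F [G xs])"
    using recursive.comp[of "[G]" F n] by simp
  then show ?thesis
    unfolding recursive_on_def using eq by (intro exI[of _ "\<lambda>xs. F [G xs]"]) auto
qed

lemma recursive_on_comp2:
  assumes "recursive_on 2 f" "recursive_on n g" "recursive_on n h"
  shows "recursive_on n (\<lambda>xs. f [g xs, h xs])"
proof -
  obtain F G H where "recursive 2 F" "recursive n G" "recursive n H"
    and eq: "\<forall>xs. length xs = 2 \<longrightarrow> F xs = f xs" "\<forall>xs. length xs = n \<longrightarrow> G xs = g xs"
      "\<forall>xs. length xs = n \<longrightarrow> H xs = h xs"
    using assms unfolding recursive_on_def by metis
  then have "recursive n (\<lambda>xs. F [G xs, H xs])"
    using recursive.comp[of "[G, H]" F n] by (auto simp: numeral_2_eq_2)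
  then show ?thesis
    unfolding recursive_on_def using eq by (intro exI[of _ "\<lambda>xs. F [G xs, H xs]"]) auto
qed

lemma recursive_on_prim_rec:
  assumes "recursive_on n f" "recursive_on (Suc (Suc n)) g"
  shows "recursive_on (Suc n) (\<lambda>xs. rec_nat (f (tl xs)) (\<lambda>k r. g (k # r # tl xs)) (hd xs))"
proof -
  obtain F G where "recursive n F" "recursive (Suc (Suc n)) G"
    and eq: "\<forall>xs. length xs = n \<longrightarrow> F xs = f xs" "\<forall>xs. length xs = Suc (Suc n) \<longrightarrow> G xs = g xs"
    using assms unfolding recursive_on_def by metis
  then have "recursive (Suc n) (\<lambda>xs. rec_nat (F (tl xs)) (\<lambda>k r. G (k # r # tl xs)) (hd xs))"
    by (intro recursive.prim_rec)
  then show ?thesis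
    unfolding recursive_on_def using eq
    by (intro exI[of _ "\<lambda>xs. rec_nat (F (tl xs)) (\<lambda>k r. G (k # r # tl xs)) (hd xs)"]) auto
qed

lemma recursive_on_Least:
  assumes "recursive_on (Suc n) f" "\<And>xs. length xs = n \<Longrightarrow> \<exists>y. f (y # xs) = 0"
  shows "recursive_on n (\<lambda>xs. LEAST y. f (y # xs) = 0)"
proof -
  obtain F where "recursive (Suc n) F" and eq: "\<forall>xs. length xs = Suc n \<longrightarrow> F xs = f xs"
    using assms(1) unfolding recursive_on_def by metis
  then have "recursive n (\<lambda>xs. LEAST y. F (y # xs) = 0)"
    using assms(2) by (intro recursive.minim) auto
  then show ?thesis
    unfolding recursive_on_def using eq
    by (intro exI[of _ "\<lambda>xs. LEAST y. F (y # xs) = 0"]) auto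
qed

lemma recursive_on_proj: "i < n \<Longrightarrow> recursive_on n (\<lambda>xs. xs ! i)"
  by (intro recursive_onI recursive.proj)

lemma recursive_on_Suc: "recursive_on n g \<Longrightarrow> recursive_on n (\<lambda>xs. Suc (g xs))"
  using recursive_on_comp1[OF recursive_onI[OF recursive.succ]] by simp

lemma recursive_on_const: "recursive_on n (\<lambda>xs. c)"
  by (induction c) (auto intro: recursive_onI recursive.zero recursive_on_Suc)

lemma recursive_on_add:
  assumes "recursive_on n f" "recursive_on n g"
  shows "recursive_on n (\<lambda>xs. f xs + g xs)"
proof -
  have *: "rec_nat b (\<lambda>k. Suc) a = a + b" for a b :: nat
    by (induction a) auto
  have "recursive_on (Suc 1) (\<lambda>xs. rec_nat (tl xs ! 0) (\<lambda>k r. Suc ((k # r # tl xs) ! 1)) (hd xs))"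
    by (intro recursive_on_prim_rec recursive_on_Suc recursive_on_proj) auto
  then have "recursive_on 2 (\<lambda>xs. xs ! 0 + xs ! 1)"
    by (auto elim!: recursive_on_cong simp: * numeral_2_eq_2 length_Suc_conv)
  from recursive_on_comp2[OF this assms] show ?thesis by simp
qed

lemma recursive_on_pred: "recursive_on n f \<Longrightarrow> recursive_on n (\<lambda>xs. f xs - 1)"
proof -
  assume f: "recursive_on n f"
  have *: "rec_nat 0 (\<lambda>k r. k) a = a - 1" for a :: nat
    by (induction a) auto
  have "recursive_on (Suc 0) (\<lambda>xs. rec_nat 0 (\<lambda>k r. (k # r # tl xs) ! 0) (hd xs))"
    by (intro recursive_on_prim_rec recursive_on_const recursive_on_proj) auto
  then have "recursive_on 1 (\<lambda>xs. xs ! 0 - 1)"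
    by (auto elim!: recursive_on_cong simp: * length_Suc_conv)
  from recursive_on_comp1[OF this f] show ?thesis by simp
qed

lemma recursive_on_diff:
  assumes "recursive_on n f" "recursive_on n g"
  shows "recursive_on n (\<lambda>xs. f xs - g xs)"
proof -
  have *: "rec_nat b (\<lambda>k r. r - Suc 0) a = b - a" for a b :: nat
    by (induction a) auto
  have "recursive_on (Suc 1) (\<lambda>xs. rec_nat (tl xs ! 0) (\<lambda>k r. (k # r # tl xs) ! 1 - 1) (hd xs))"
    by (intro recursive_on_prim_rec recursive_on_pred recursive_on_proj) auto
  then have "recursive_on 2 (\<lambda>xs. xs ! 1 - xs ! 0)"
    by (auto elim!: recursive_on_cong simp: * numeral_2_eq_2 length_Suc_conv)
  from recursive_on_comp2[OF this assms(2,1)] show ?thesis by simp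
qed

lemma recursive_on_triangle:
  assumes "recursive_on n f"
  shows "recursive_on n (\<lambda>xs. triangle (f xs))"
proof -
  have *: "rec_nat 0 (\<lambda>k r. r + Suc k) a = triangle a" for a :: nat
    by (induction a) auto
  have "recursive_on (Suc 0)
      (\<lambda>xs. rec_nat 0 (\<lambda>k r. (k # r # tl xs) ! 1 + Suc ((k # r # tl xs) ! 0)) (hd xs))"
    by (intro recursive_on_prim_rec recursive_on_const recursive_on_add recursive_on_Suc
        recursive_on_proj) auto
  then have "recursive_on 1 (\<lambda>xs. triangle (xs ! 0))"
    by (auto elim!: recursive_on_cong simp: *[simplified] length_Suc_conv)
  from recursive_on_comp1[OF this assms] show ?thesis by simp
qed

lemma recursive_on_prod_encode:
  "recursive_on n f \<Longrightarrow> recursive_on n g \<Longrightarrow> recursive_on n (\<lambda>xs. prod_encode (f xs, g xs))"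
  unfolding prod_encode_def prod.case
  by (intro recursive_on_add recursive_on_triangle) auto

text \<open>
  \<open>prod_encode\<close> counts along the diagonals \<open>a + b = w\<close>, the first code on each being \<open>triangle w\<close>. So the
  diagonal of a pair is found from its code by unbounded search, and then both components by subtraction.
\<close>

lemma diagonal_eq_Least:
  "fst (prod_decode z) + snd (prod_decode z) = (LEAST w. Suc z - triangle (Suc w) = 0)"
proof -
  obtain a b where z: "z = prod_encode (a, b)"
    by (metis prod_decode_inverse surj_pair)
  have mono: "triangle x \<le> triangle y" if "x \<le> y" for x y
    using that by (induction rule: dec_induct) auto
  have "(LEAST w. Suc z - triangle (Suc w) = 0) = a + b"
  proof (rule Least_equality)
    show "Suc z - triangle (Suc (a + b)) = 0"
      by (simp add: z prod_encode_def)
  next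
    fix w assume "Suc z - triangle (Suc w) = 0"
    then have "triangle (a + b) < triangle (Suc w)"
      by (simp add: z prod_encode_def)
    then show "a + b \<le> w"
      using mono[of "Suc w" "a + b"] by (meson leI le_antisym not_less not_less_eq_eq)
  qed
  then show ?thesis by (simp add: z)
qed

lemma recursive_on_prod_decode:
  assumes "recursive_on n f"
  shows "recursive_on n (\<lambda>xs. fst (prod_decode (f xs)))"
    and "recursive_on n (\<lambda>xs. snd (prod_decode (f xs)))"
proof -
  define r where "r z = fst (prod_decode z) + snd (prod_decode z)" for z
  have "recursive_on 2 (\<lambda>xs. Suc (xs ! 1) - triangle (Suc (xs ! 0)))"
    by (intro recursive_on_diff recursive_on_triangle recursive_on_Suc recursive_on_proj) auto
  moreover have "\<exists>w. Suc z - triangle (Suc w) = 0" for z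
    by (intro exI[of _ z]) auto
  ultimately have "recursive_on 1 (\<lambda>xs. r (xs ! 0))"
    unfolding r_def diagonal_eq_Least
    using recursive_on_Least[of 1 "\<lambda>xs. Suc (xs ! 1) - triangle (Suc (xs ! 0))"]
    by (simp add: numeral_2_eq_2)
  from recursive_on_comp1[OF this assms] have r: "recursive_on n (\<lambda>xs. r (f xs))" by simp
  have 1: "fst (prod_decode z) = z - triangle (r z)" for z
    using prod_decode_inverse[of z] unfolding r_def prod_encode_def
    by (metis (no_types, lifting) add_diff_cancel_left' case_prod_unfold)
  show f: "recursive_on n (\<lambda>xs. fst (prod_decode (f xs)))"
    unfolding 1 by (intro recursive_on_diff recursive_on_triangle r assms)
  have 2: "snd (prod_decode z) = r z - fst (prod_decode z)" for z
    by (simp add: r_def)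
  show "recursive_on n (\<lambda>xs. snd (prod_decode (f xs)))"
    unfolding 2 by (intro recursive_on_diff f r)
qed


section \<open>Computable functions between coded types\<close>

text \<open>
  Coded types give one notion of computability for numbers, strings, truth values and tuples, and
  turn the management of arities into the construction of pairs.
\<close>

class coded =
  fixes enc :: "'a \<Rightarrow> nat"

instantiation nat :: coded
begin
definition enc_nat :: "nat \<Rightarrow> nat" where [simp]: "enc_nat n = n"
instance ..
end

instantiation bool :: coded
begin
definition enc_bool :: "bool \<Rightarrow> nat" where [simp]: "enc_bool b = of_bool b"
instance ..
end

instantiation prod :: (coded, coded) coded
begin
definition enc_prod :: "'a \<times> 'b \<Rightarrow> nat" where
  [simp]: "enc_prod p = prod_encode (enc (fst p), enc (snd p))"
instance ..
end

text \<open>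
  The coding is chosen to coincide with \<open>str_code\<close> on \<open>bool list\<close>.
\<close>

instantiation list :: (coded) coded
begin
definition enc_list :: "'a list \<Rightarrow> nat" where
  "enc_list xs = foldl (\<lambda>n x. 2 * n + Suc (enc x)) 0 xs"
instance ..
end

lemma enc_string [simp]: "enc (\<sigma> :: bool list) = str_code \<sigma>"
proof -
  have *: "(\<lambda>n x. 2 * n + Suc (enc x)) = (\<lambda>n b. 2 * n + (if b then 2 else 1 :: nat))"
    by (auto simp: fun_eq_iff)
  show ?thesis unfolding enc_list_def str_code_def * ..
qed

definition computable :: "('a::coded \<Rightarrow> 'b::coded) \<Rightarrow> bool" where
  "computable f \<longleftrightarrow> (\<exists>F. recursive_on 1 F \<and> (\<forall>x. F [enc x] = enc (f x)))"

named_theorems computable_intros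

lemma computable_comp:
  assumes "computable f" "computable g"
  shows "computable (\<lambda>x. f (g x))"
proof -
  obtain F G where "recursive_on 1 F" "recursive_on 1 G"
    and "\<forall>x. F [enc x] = enc (f x)" "\<forall>x. G [enc x] = enc (g x)"
    using assms unfolding computable_def by metis
  then show ?thesis
    unfolding computable_def
    by (intro exI[of _ "\<lambda>xs. F [G xs]"]) (auto intro: recursive_on_comp1)
qed

lemma computable_id [computable_intros]: "computable (\<lambda>x. x)"
  unfolding computable_def by (rule exI[of _ "\<lambda>xs. xs ! 0"]) (simp add: recursive_on_proj)

lemma computable_const [computable_intros]: "computable (\<lambda>x. c)"
  unfolding computable_def by (rule exI[of _ "\<lambda>xs. enc c"]) (simp add: recursive_on_const)

lemma computable_Suc [computable_intros]:
  assumes "computable f"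
  shows "computable (\<lambda>x. Suc (f x))"
proof -
  have "computable Suc"
    unfolding computable_def
    by (rule exI[of _ "\<lambda>xs. Suc (xs ! 0)"]) (auto intro: recursive_on_Suc recursive_on_proj)
  from computable_comp[OF this assms] show ?thesis .
qed

lemma computable_Pair [computable_intros]:
  assumes "computable f" "computable g"
  shows "computable (\<lambda>x. (f x, g x))"
proof -
  obtain F G where "recursive_on 1 F" "recursive_on 1 G"
    and "\<forall>x. F [enc x] = enc (f x)" "\<forall>x. G [enc x] = enc (g x)"
    using assms unfolding computable_def by metis
  then show ?thesis
    unfolding computable_def
    by (intro exI[of _ "\<lambda>xs. prod_encode (F xs, G xs)"]) (auto intro: recursive_on_prod_encode)
qed

lemma computable_comp2:
  assumes "computable (\<lambda>p. f (fst p) (snd p))" "computable g" "computable h"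
  shows "computable (\<lambda>x. f (g x) (h x))"
  using computable_comp[OF assms(1) computable_Pair[OF assms(2,3)]] by simp

lemma computable_fst [computable_intros]:
  assumes "computable f"
  shows "computable (\<lambda>x. fst (f x))"
proof -
  have "computable (fst :: 'b \<times> 'c \<Rightarrow> 'b)"
    unfolding computable_def
    by (rule exI[of _ "\<lambda>xs. fst (prod_decode (xs ! 0))"])
      (auto intro: recursive_on_prod_decode recursive_on_proj)
  from computable_comp[OF this assms] show ?thesis .
qed

lemma computable_snd [computable_intros]:
  assumes "computable f"
  shows "computable (\<lambda>x. snd (f x))"
proof -
  have "computable (snd :: 'b \<times> 'c \<Rightarrow> 'c)"
    unfolding computable_def
    by (rule exI[of _ "\<lambda>xs. snd (prod_decode (xs ! 0))"])
      (auto intro: recursive_on_prod_decode recursive_on_proj)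
  from computable_comp[OF this assms] show ?thesis .
qed

text \<open>
  Arithmetic, conditionals, bounded quantifiers and bounded sums are all instances of primitive
  recursion with a parameter of arbitrary coded type. In the premises of this and the following
  rules, the bound variables appear as components of one argument, so that the rules apply to nested
  binders without any adjustment of arities.
\<close>

lemma computable_rec_nat [computable_intros]:
  fixes f :: "'a::coded \<Rightarrow> 'b::coded"
  assumes "computable f" and "computable (\<lambda>p. g (fst p) (fst (snd p)) (snd (snd p)))"
    and h: "computable h"
  shows "computable (\<lambda>x. rec_nat (f x) (\<lambda>k r. g k r x) (h x))"
proof -
  obtain F G where F: "recursive_on 1 F" and G: "recursive_on 1 G"
    and F_eq: "\<And>x. F [enc x] = enc (f x)"
    and G_eq: "\<And>p. G [enc p] = enc (g (fst p) (fst (snd p)) (snd (snd p)))"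
    using assms(1,2) unfolding computable_def by metis
  have "recursive_on 3 (\<lambda>xs. G [prod_encode (xs ! 0, prod_encode (xs ! 1, xs ! 2))])"
    by (intro recursive_on_comp1[OF G] recursive_on_prod_encode recursive_on_proj) auto
  then have R: "recursive_on 2 (\<lambda>xs. rec_nat (F [xs ! 1])
      (\<lambda>k r. G [prod_encode (k, prod_encode (r, xs ! 1))]) (xs ! 0))"
    using recursive_on_prim_rec[OF F, of "\<lambda>xs. G [prod_encode (xs ! 0, prod_encode (xs ! 1, xs ! 2))]"]
    by (auto elim!: recursive_on_cong simp: numeral_3_eq_3 numeral_2_eq_2 length_Suc_conv)
  have "rec_nat (F [enc x]) (\<lambda>k r. G [prod_encode (k, prod_encode (r, enc x))]) n
      = enc (rec_nat (f x) (\<lambda>k r. g k r x) n)" for x n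
  proof (induction n)
    case 0
    then show ?case by (simp add: F_eq)
  next
    case (Suc n)
    then show ?case
      using G_eq[of "(n, rec_nat (f x) (\<lambda>k r. g k r x) n, x)"] by simp
  qed
  then have "computable (\<lambda>p. rec_nat (f (snd p)) (\<lambda>k r. g k r (snd p)) (fst p))"
    unfolding computable_def
    using recursive_on_comp2[OF R recursive_on_prod_decode[OF recursive_on_proj[of 0 1]]]
    by (intro exI[of _ "\<lambda>xs. rec_nat (F [snd (prod_decode (xs ! 0))])
      (\<lambda>k r. G [prod_encode (k, prod_encode (r, snd (prod_decode (xs ! 0))))])
      (fst (prod_decode (xs ! 0)))"]) simp
  from computable_comp[OF this computable_Pair[OF h computable_id]] show ?thesis by simp
qed

lemma computable_of_bool [computable_intros]:
  "computable f \<Longrightarrow> computable (\<lambda>x. of_bool (f x) :: nat)"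
  unfolding computable_def by simp

lemma computable_If [computable_intros]:
  assumes "computable b" "computable f" "computable g"
  shows "computable (\<lambda>x. if b x then f x else g x)"
proof -
  have eq: "(if b x then f x else g x) = rec_nat (g x) (\<lambda>k r. f x) (of_bool (b x))" for x
    by simp
  show ?thesis unfolding eq by (intro computable_intros computable_comp[OF assms(2)] assms)
qed

lemma computable_add [computable_intros]:
  assumes "computable f" "computable g"
  shows "computable (\<lambda>x. f x + g x :: nat)"
proof -
  have eq: "a + b = rec_nat a (\<lambda>k. Suc) b" for a b :: nat
    by (induction b) auto
  show ?thesis unfolding eq by (intro computable_intros assms)
qed

lemma computable_mult [computable_intros]:
  assumes "computable f" "computable g"
  shows "computable (\<lambda>x. f x * g x :: nat)"
proof -
  have eq: "a * b = rec_nat 0 (\<lambda>k r. r + a) b" for a b :: nat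
    by (induction b) auto
  show ?thesis unfolding eq by (intro computable_intros computable_comp[OF assms(1)] assms)
qed

lemma computable_power [computable_intros]:
  assumes "computable f" "computable g"
  shows "computable (\<lambda>x. f x ^ g x :: nat)"
proof -
  have eq: "a ^ b = rec_nat 1 (\<lambda>k r. r * a) b" for a b :: nat
    by (induction b) auto
  show ?thesis unfolding eq by (intro computable_intros computable_comp[OF assms(1)] assms)
qed

lemma computable_diff [computable_intros]:
  assumes "computable f" "computable g"
  shows "computable (\<lambda>x. f x - g x :: nat)"
proof -
  define pred :: "nat \<Rightarrow> nat" where "pred a = rec_nat 0 (\<lambda>k r. k) a" for a
  have "pred a = a - 1" for a
    by (cases a) (auto simp: pred_def)
  then have eq: "a - b = rec_nat a (\<lambda>k. pred) b" for a b :: nat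
    by (induction b) auto
  show ?thesis unfolding eq unfolding pred_def by (intro computable_intros assms)
qed

lemma computable_not [computable_intros]:
  assumes "computable f"
  shows "computable (\<lambda>x. \<not> f x)"
proof -
  have eq: "(\<not> b) = (if b then False else True)" for b by auto
  show ?thesis unfolding eq by (intro computable_intros assms)
qed

lemma computable_conj [computable_intros]:
  assumes "computable f" "computable g"
  shows "computable (\<lambda>x. f x \<and> g x)"
proof -
  have eq: "(a \<and> b) = (if a then b else False)" for a b by auto
  show ?thesis unfolding eq by (intro computable_intros assms)
qed

lemma computable_disj [computable_intros]:
  assumes "computable f" "computable g"
  shows "computable (\<lambda>x. f x \<or> g x)"
proof -
  have eq: "(a \<or> b) = (if a then True else b)" for a b by auto
  show ?thesis unfolding eq by (intro computable_intros assms)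
qed

lemma computable_le [computable_intros]:
  assumes "computable f" "computable g"
  shows "computable (\<lambda>x. f x \<le> (g x :: nat))"
proof -
  have eq: "(a \<le> b) = rec_nat True (\<lambda>k r. False) (a - b)" for a b :: nat
    by (cases "a - b") auto
  show ?thesis unfolding eq by (intro computable_intros assms)
qed

lemma computable_less [computable_intros]:
  assumes "computable f" "computable g"
  shows "computable (\<lambda>x. f x < (g x :: nat))"
  unfolding less_eq_Suc_le by (intro computable_intros assms)

lemma computable_eq_nat [computable_intros]:
  assumes "computable f" "computable g"
  shows "computable (\<lambda>x. f x = (g x :: nat))"
  unfolding eq_iff by (intro computable_intros assms)

lemma computable_bex [computable_intros]:
  fixes h :: "'a::coded \<Rightarrow> nat"
  assumes "computable (\<lambda>p. P (fst p) (snd p))" "computable h"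
  shows "computable (\<lambda>x. \<exists>i<h x. P i x)"
proof -
  have eq: "(\<exists>i<n. P i x) = rec_nat False (\<lambda>i r. r \<or> P i x) n" for n x
    by (induction n) (auto simp: less_Suc_eq)
  show ?thesis unfolding eq by (intro computable_intros computable_comp2[OF assms(1)] assms(2))
qed

lemma computable_sum [computable_intros]:
  fixes h :: "'a::coded \<Rightarrow> nat" and f :: "nat \<Rightarrow> 'a \<Rightarrow> nat"
  assumes "computable (\<lambda>p. f (fst p) (snd p))" "computable h"
  shows "computable (\<lambda>x. \<Sum>i<h x. f i x)"
proof -
  have eq: "(\<Sum>i<n. f i x) = rec_nat 0 (\<lambda>i r. r + f i x) n" for n x
    by (induction n) auto
  show ?thesis unfolding eq by (intro computable_intros computable_comp2[OF assms(1)] assms(2))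
qed

text \<open>
  Minimization is admitted only for functions that have a zero at every tuple of arguments. The
  parameter is therefore a number: there every natural number is a code.
\<close>

lemma computable_Least:
  fixes P :: "nat \<Rightarrow> nat \<Rightarrow> bool"
  assumes "computable (\<lambda>p. P (fst p) (snd p))" and ex: "\<And>x. \<exists>y. P y x"
  shows "computable (\<lambda>x. LEAST y. P y x)"
proof -
  obtain F where F: "recursive_on 1 F"
    and eq: "\<And>p. F [enc p] = (of_bool (\<not> P (fst p) (snd p)) :: nat)"
    using computable_not[OF assms(1)] unfolding computable_def by auto
  have "recursive_on 2 (\<lambda>xs. F [prod_encode (xs ! 0, xs ! 1)])"
    by (intro recursive_on_comp1[OF F] recursive_on_prod_encode recursive_on_proj) auto
  moreover have F0: "F [prod_encode (y, x)] = 0 \<longleftrightarrow> P y x" for x y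
    using eq[of "(y, x)"] by simp
  ultimately have "recursive_on 1 (\<lambda>xs. LEAST y. P y (xs ! 0))"
    using recursive_on_Least[of 1 "\<lambda>xs. F [prod_encode (xs ! 0, xs ! 1)]"] ex
    by (simp add: numeral_2_eq_2)
  then show ?thesis
    unfolding computable_def by (intro exI[of _ "\<lambda>xs. LEAST y. P y (xs ! 0)"]) simp
qed

lemma computable_nat1_iff: "computable (f :: nat \<Rightarrow> nat) \<longleftrightarrow> (\<exists>F. recursive 1 F \<and> (\<forall>x. F [x] = f x))"
  unfolding computable_def recursive_on_def
  by (auto simp: length_Suc_conv)

lemma computable_nat2_iff:
  "computable (f :: nat \<times> nat \<Rightarrow> nat) \<longleftrightarrow> (\<exists>F. recursive 2 F \<and> (\<forall>x y. F [x, y] = f (x, y)))"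
proof
  assume "computable f"
  then obtain F where F: "recursive_on 1 F" and eq: "\<And>p. F [enc p] = f p"
    unfolding computable_def by auto
  have "recursive_on 2 (\<lambda>xs. F [prod_encode (xs ! 0, xs ! 1)])"
    by (intro recursive_on_comp1[OF F] recursive_on_prod_encode recursive_on_proj) auto
  then obtain G where "recursive 2 G" "\<And>xs. length xs = 2 \<Longrightarrow> G xs = F [prod_encode (xs ! 0, xs ! 1)]"
    unfolding recursive_on_def by auto
  then show "\<exists>F. recursive 2 F \<and> (\<forall>x y. F [x, y] = f (x, y))"
    using eq[of "(_, _)"] by (intro exI[of _ G]) auto
next
  assume "\<exists>F. recursive 2 F \<and> (\<forall>x y. F [x, y] = f (x, y))"
  then obtain F where F: "recursive 2 F" and eq: "\<And>x y. F [x, y] = f (x, y)"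
    by auto
  show "computable f"
    unfolding computable_def
    using recursive_on_comp2[OF recursive_onI[OF F] recursive_on_prod_decode[OF recursive_on_proj[of 0 1]]]
    by (intro exI[of _ "\<lambda>xs. F [fst (prod_decode (xs ! 0)), snd (prod_decode (xs ! 0))]"])
      (auto simp: eq)
qed


section \<open>Computing with strings\<close>

lemma str_code_Nil [simp]: "str_code [] = 0"
  by (simp add: str_code_def)

lemma str_code_snoc [simp]: "str_code (\<sigma> @ [b]) = 2 * str_code \<sigma> + (if b then 2 else 1)"
  by (simp add: str_code_def)

lemma str_code_append: "str_code (\<sigma> @ \<tau>) = str_code \<sigma> * 2 ^ length \<tau> + str_code \<tau>"
proof (induction \<tau> rule: rev_induct)
  case (snoc b \<tau>)
  have "str_code (\<sigma> @ \<tau> @ [b]) = 2 * str_code (\<sigma> @ \<tau>) + (if b then 2 else 1)"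
    using str_code_snoc[of "\<sigma> @ \<tau>" b] by simp
  then show ?case by (simp add: snoc.IH)
qed simp

text \<open>
  The binary notation of \<open>Suc (str_code \<sigma>)\<close> is \<open>1\<close> followed by the digits of \<open>\<sigma>\<close>.
\<close>

lemma str_code_bounds: "2 ^ length \<sigma> \<le> Suc (str_code \<sigma>) \<and> Suc (str_code \<sigma>) < 2 ^ Suc (length \<sigma>)"
  by (induction \<sigma> rule: rev_induct) auto

lemma bij_str_code: "bij str_code"
proof (rule bijI)
  show "inj str_code"
  proof (rule injI)
    fix \<sigma> \<tau> :: "bool list" assume "str_code \<sigma> = str_code \<tau>"
    then show "\<sigma> = \<tau>"
    proof (induction \<sigma> arbitrary: \<tau> rule: rev_induct)
      case Nil
      then show ?case by (cases \<tau> rule: rev_cases) (auto split: if_splits)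
    next
      case (snoc b \<sigma>)
      then obtain c \<rho> where \<tau>: "\<tau> = \<rho> @ [c]"
        by (cases \<tau> rule: rev_cases) (auto split: if_splits)
      with snoc.prems have "2 * str_code \<sigma> + (if b then 2 else 1) = 2 * str_code \<rho> + (if c then 2 else 1)"
        by simp
      then have "str_code \<sigma> = str_code \<rho> \<and> b = c"
        by (cases b; cases c; simp; presburger)
      then show ?case using snoc.IH \<tau> by simp
    qed
  qed
  show "surj str_code"
  proof (rule surjI[where f = "\<lambda>n. SOME \<sigma>. str_code \<sigma> = n"], rule someI_ex)
    fix n show "\<exists>\<sigma>. str_code \<sigma> = n"
    proof (induction n rule: less_induct)
      case (less n)
      consider "n = 0" | m where "n = 2 * m + 1" | m where "n = 2 * m + 2"
        by (metis One_nat_def add_2_eq_Suc' evenE not0_implies_Suc oddE mult_Suc_right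
            add.commute mult_eq_0_iff nat.distinct(1))
      then show ?case
      proof cases
        case 1
        then show ?thesis by (intro exI[of _ "[]"]) simp
      next
        case (2 m)
        then obtain \<sigma> where "str_code \<sigma> = m" using less[of m] by auto
        with 2 show ?thesis by (intro exI[of _ "\<sigma> @ [False]"]) simp
      next
        case (3 m)
        then obtain \<sigma> where "str_code \<sigma> = m" using less[of m] by auto
        with 3 show ?thesis by (intro exI[of _ "\<sigma> @ [True]"]) simp
      qed
    qed
  qed
qed

text \<open>
  Since \<open>string_of\<close> is the identity on codes, it is computable for free, and a function to strings is
  computable as soon as the code of its value is.
\<close>

definition string_of :: "nat \<Rightarrow> bool list" where
  "string_of = inv str_code"

lemma string_of_str_code [simp]: "string_of (str_code \<sigma>) = \<sigma>"
  by (simp add: string_of_def bij_str_code bij_is_inj inv_f_f)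

lemma str_code_string_of [simp]: "str_code (string_of n) = n"
  by (simp add: string_of_def bij_str_code bij_is_surj surj_f_inv_f)

lemma str_code_eq_iff [simp]: "str_code \<sigma> = str_code \<tau> \<longleftrightarrow> \<sigma> = \<tau>"
  by (metis string_of_str_code)

lemma computable_str_code [computable_intros]:
  "computable f \<Longrightarrow> computable (\<lambda>x. str_code (f x))"
  unfolding computable_def by simp

lemma computable_string_of [computable_intros]:
  "computable f \<Longrightarrow> computable (\<lambda>x. string_of (f x))"
  unfolding computable_def by simp

lemma length_eq_Least: "length \<sigma> = (LEAST l. Suc (str_code \<sigma>) < 2 ^ Suc l)"
proof (rule Least_equality[symmetric])
  show "Suc (str_code \<sigma>) < 2 ^ Suc (length \<sigma>)"
    using str_code_bounds by blast
next
  fix l assume "Suc (str_code \<sigma>) < 2 ^ Suc l"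
  with str_code_bounds[of \<sigma>] have "(2::nat) ^ length \<sigma> < 2 ^ Suc l"
    by linarith
  then show "length \<sigma> \<le> l" by (simp del: power_Suc)
qed

lemma computable_length [computable_intros]:
  fixes f :: "'a::coded \<Rightarrow> bool list"
  assumes "computable f"
  shows "computable (\<lambda>x. length (f x))"
proof -
  have "\<exists>l. Suc c < 2 ^ Suc l" for c :: nat
    by (rule exI[of _ c]) (metis less_exp Suc_leI le_less_trans power_strict_increasing lessI
        one_less_numeral_iff semiring_norm(76))
  then have "computable (\<lambda>c. LEAST l. Suc c < 2 ^ Suc l)"
    by (intro computable_Least computable_intros)
  from computable_comp[OF this computable_str_code[OF assms]] show ?thesis
    unfolding length_eq_Least .
qed

lemma length_string_of_iff: "length (string_of n) = l \<longleftrightarrow> 2 ^ l \<le> Suc n \<and> Suc n < 2 ^ Suc l"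
proof
  assume "length (string_of n) = l"
  then show "2 ^ l \<le> Suc n \<and> Suc n < 2 ^ Suc l"
    using str_code_bounds[of "string_of n"] by simp
next
  assume *: "2 ^ l \<le> Suc n \<and> Suc n < 2 ^ Suc l"
  let ?m = "length (string_of n)"
  have "2 ^ ?m \<le> Suc n \<and> Suc n < 2 ^ Suc ?m"
    using str_code_bounds[of "string_of n"] by simp
  with * have "(2::nat) ^ l < 2 ^ Suc ?m" "(2::nat) ^ ?m < 2 ^ Suc l"
    by linarith+
  then show "?m = l" by (simp del: power_Suc)
qed

lemma computable_append [computable_intros]:
  fixes f g :: "'a::coded \<Rightarrow> bool list"
  assumes "computable f" "computable g"
  shows "computable (\<lambda>x. f x @ g x)"
proof -
  have eq: "\<sigma> @ \<tau> = string_of (str_code \<sigma> * 2 ^ length \<tau> + str_code \<tau>)" for \<sigma> \<tau>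
    by (metis str_code_append string_of_str_code)
  show ?thesis unfolding eq by (intro computable_intros assms)
qed

lemma computable_div2 [computable_intros]:
  assumes "computable f"
  shows "computable (\<lambda>x. f x div 2 :: nat)"
proof -
  have eq: "n div 2 = (LEAST y. n < 2 * Suc y)" for n :: nat
    by (rule Least_equality[symmetric]) auto
  have "\<exists>y. n < 2 * Suc y" for n :: nat
    by (rule exI[of _ n]) auto
  then have "computable (\<lambda>n. LEAST y. n < 2 * Suc y)"
    by (intro computable_Least computable_intros)
  from computable_comp[OF this assms] show ?thesis
    unfolding eq .
qed

lemma computable_butlast [computable_intros]:
  fixes f :: "'a::coded \<Rightarrow> bool list"
  assumes "computable f"
  shows "computable (\<lambda>x. butlast (f x))"
proof -
  have "str_code (butlast \<sigma>) = (str_code \<sigma> - 1) div 2" for \<sigma>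
    by (cases \<sigma> rule: rev_cases) auto
  then have eq: "butlast \<sigma> = string_of ((str_code \<sigma> - 1) div 2)" for \<sigma>
    by (metis string_of_str_code)
  show ?thesis unfolding eq by (intro computable_intros assms)
qed

lemma computable_take [computable_intros]:
  fixes f :: "'a::coded \<Rightarrow> bool list"
  assumes "computable k" "computable f"
  shows "computable (\<lambda>x. take (k x) (f x))"
proof -
  have *: "rec_nat \<sigma> (\<lambda>i. butlast) m = take (length \<sigma> - m) \<sigma>" for \<sigma> :: "bool list" and m
    by (induction m) (auto simp: butlast_take)
  have eq: "take k \<sigma> = rec_nat \<sigma> (\<lambda>i. butlast) (length \<sigma> - k)" for \<sigma> :: "bool list" and k
    unfolding * by (cases "k \<le> length \<sigma>") auto
  show ?thesis unfolding eq by (intro computable_intros assms)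
qed

lemma finite_strings: "finite {\<tau> :: bool list. length \<tau> = l \<and> P \<tau>}"
  by (rule finite_subset[OF _ finite_lists_length_eq[of "UNIV :: bool set" l]]) auto

text \<open>
  Measures of clopen sets are such cardinalities, divided by a power of two. The strings of length \<open>l\<close>
  have the consecutive codes from \<open>2 ^ l - 1\<close> on.
\<close>

lemma computable_card_strings [computable_intros]:
  assumes "computable (\<lambda>p. P (fst p) (snd p))" "computable h"
  shows "computable (\<lambda>x. card {\<tau> :: bool list. length \<tau> = h x \<and> P \<tau> x})"
proof -
  have eq: "card {\<tau>. length \<tau> = l \<and> Q \<tau>} = (\<Sum>i<2 ^ l. of_bool (Q (string_of (i + (2 ^ l - 1)))))"
    for l and Q :: "bool list \<Rightarrow> bool"
  proof -
    have bij: "bij_betw (\<lambda>i. string_of (i + (2 ^ l - 1))) {..<2 ^ l} {\<tau>. length \<tau> = l}"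
    proof (rule bij_betwI[where g = "\<lambda>\<tau>. str_code \<tau> - (2 ^ l - 1)"])
      show "(\<lambda>i. string_of (i + (2 ^ l - 1))) \<in> {..<2 ^ l} \<rightarrow> {\<tau>. length \<tau> = l}"
        by (auto simp: length_string_of_iff)
      show "(\<lambda>\<tau>. str_code \<tau> - (2 ^ l - 1)) \<in> {\<tau>. length \<tau> = l} \<rightarrow> {..<2 ^ l}"
      proof (rule funcsetI)
        fix \<tau> :: "bool list" assume "\<tau> \<in> {\<tau>. length \<tau> = l}"
        with str_code_bounds[of \<tau>] have "Suc (str_code \<tau>) < 2 * 2 ^ l" by simp
        then show "str_code \<tau> - (2 ^ l - 1) \<in> {..<2 ^ l}"
          unfolding lessThan_iff by linarith
      qed
      show "string_of (str_code \<tau> - (2 ^ l - 1) + (2 ^ l - 1)) = \<tau>" if "\<tau> \<in> {\<tau>. length \<tau> = l}" for \<tau>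
        using str_code_bounds[of \<tau>] that by auto
    qed simp
    have "card {\<tau>. length \<tau> = l \<and> Q \<tau>} = (\<Sum>\<tau> | length \<tau> = l. of_bool (Q \<tau>))"
      using finite_strings[of l "\<lambda>_. True"] by (simp add: sum_of_bool_eq Int_def)
    also have "\<dots> = (\<Sum>i<2 ^ l. of_bool (Q (string_of (i + (2 ^ l - 1)))))"
      by (rule sum.reindex_bij_betw[OF bij, symmetric])
    finally show ?thesis .
  qed
  show ?thesis unfolding eq by (intro computable_intros computable_comp2[OF assms(1)] computable_comp[OF assms(2)] assms(2))
qed

section \<open>Countability\<close>

text \<open>
  Programs are finite objects, one constructor for each way of building a recursive function, so there
  are only countably many of them.
\<close>

datatype program =
    Zero | Succ | Proj nat | Comp program "program list" | Rec program program | Min program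

instance program :: countable
  by countable_datatype

primrec run :: "program \<Rightarrow> nat list \<Rightarrow> nat" where
  "run Zero = (\<lambda>xs. 0)"
| "run Succ = (\<lambda>xs. Suc (xs ! 0))"
| "run (Proj i) = (\<lambda>xs. xs ! i)"
| "run (Comp f gs) = (\<lambda>xs. run f (map (\<lambda>g. g xs) (map run gs)))"
| "run (Rec f g) = (\<lambda>xs. rec_nat (run f (tl xs)) (\<lambda>k r. run g (k # r # tl xs)) (hd xs))"
| "run (Min f) = (\<lambda>xs. LEAST y. run f (y # xs) = 0)"

lemma recursive_imp_run: "recursive n f \<Longrightarrow> f \<in> range run"
proof (induction rule: recursive.induct)
  case (zero n)
  show ?case by (rule range_eqI[of _ _ Zero]) simp
next
  case succ
  show ?case by (rule range_eqI[of _ _ Succ]) simp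
next
  case (proj i n)
  show ?case by (rule range_eqI[of _ _ "Proj i"]) simp
next
  case (comp gs f n)
  from comp.IH obtain p q where "f = run p" "\<forall>g\<in>set gs. g = run (q g)"
    by (auto simp: image_iff) metis
  then show ?case
    by (intro range_eqI[of _ _ "Comp p (map q gs)"]) (auto intro!: arg_cong[where f = "run p"])
next
  case (prim_rec n f g)
  then obtain p q where "f = run p" "g = run q" by auto
  then show ?case by (intro range_eqI[of _ _ "Rec p q"]) simp
next
  case (minim n f)
  then obtain p where "f = run p" by auto
  then show ?case by (intro range_eqI[of _ _ "Min p"]) simp
qed

lemma countable_recursive: "countable {f. recursive n f}"
  by (rule countable_subset[of _ "range run"]) (auto dest: recursive_imp_run)


section \<open>The uniform measure\<close>

lemma prob_space_coin: "prob_space (uniform_count_measure (UNIV :: bool set))"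
  by (rule prob_space_uniform_count_measure) auto

interpretation cantor: prob_space \<mu>
  unfolding \<mu>_def by (intro prob_space_PiM prob_space_coin)

lemma space_\<mu> [simp]: "space \<mu> = UNIV"
  by (simp add: \<mu>_def space_PiM space_uniform_count_measure)

lemma coordinate_measurable: "{Z :: cantor. Z i = b} \<in> sets \<mu>"
proof -
  have "(\<lambda>Z. Z i) \<in> measurable \<mu> (uniform_count_measure (UNIV :: bool set))"
    unfolding \<mu>_def by (rule measurable_component_singleton) simp
  from measurable_sets[OF this, of "{b}"] show ?thesis
    by (simp add: sets_uniform_count_measure vimage_def)
qed

lemma cylinder_eq_INT: "cylinder \<sigma> = (\<Inter>i\<in>{..<length \<sigma>}. {Z. Z i = \<sigma> ! i})"
  by (auto simp: cylinder_def)

lemma cylinder_measurable [measurable]: "cylinder \<sigma> \<in> sets \<mu>"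
proof (cases "\<sigma> = []")
  case True
  then show ?thesis using sets.top[of \<mu>] by (simp add: cylinder_def)
next
  case False
  then show ?thesis
    unfolding cylinder_eq_INT by (intro sets.finite_INT coordinate_measurable) auto
qed

lemma open_cylinder: "open (cylinder \<sigma>)"
proof -
  have "open {Z :: cantor. Z i = b}" for i b
    using open_vimage[OF discrete_topology_class.open_discrete[of "{b}"] continuous_on_product_coordinates[of i]]
    by (simp add: vimage_def)
  then show ?thesis
    unfolding cylinder_eq_INT by (intro open_INT) auto
qed

lemma measure_cylinder: "measure \<mu> (cylinder \<sigma>) = 1 / 2 ^ length \<sigma>"
proof -
  interpret product_prob_space "\<lambda>i::nat. uniform_count_measure (UNIV :: bool set)" UNIV
    by (rule product_prob_spaceI) (rule prob_space_coin)
  have "cylinder \<sigma> = prod_emb UNIV (\<lambda>i. uniform_count_measure UNIV) {..<length \<sigma>}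
      (\<Pi>\<^sub>E i\<in>{..<length \<sigma>}. {\<sigma> ! i})"
    by (intro set_eqI) (simp add: prod_emb_iff cylinder_def space_uniform_count_measure PiE_iff Ball_def)
  then have "measure \<mu> (cylinder \<sigma>)
      = (\<Prod>i<length \<sigma>. measure (uniform_count_measure (UNIV :: bool set)) {\<sigma> ! i})"
    unfolding \<mu>_def by (simp only:) (rule measure_PiM_emb, auto simp: sets_uniform_count_measure)
  also have "\<dots> = 1 / 2 ^ length \<sigma>"
    by (simp add: measure_uniform_count_measure power_divide)
  finally show ?thesis .
qed

lemma measure_INT_eq_0:
  assumes "\<And>n. T n \<in> sets \<mu>" "\<And>n. measure \<mu> (T n) \<le> 1 / 2 ^ n"
  shows "measure \<mu> (\<Inter>n. T n) = 0"
proof -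
  have "measure \<mu> (\<Inter>n. T n) \<le> (1 / 2) ^ n" for n
  proof -
    have "measure \<mu> (\<Inter>n. T n) \<le> measure \<mu> (T n)"
      using assms(1) by (intro cantor.finite_measure_mono) auto
    then show ?thesis using assms(2)[of n] by (simp add: power_divide)
  qed
  moreover have "(\<lambda>n. (1 / 2) ^ n :: real) \<longlonglongrightarrow> 0"
    by (rule LIMSEQ_realpow_zero) auto
  ultimately have "measure \<mu> (\<Inter>n. T n) \<le> 0"
    by (intro LIMSEQ_le_const[where X = "\<lambda>n. (1 / 2) ^ n"]) auto
  then show ?thesis using measure_nonneg[of \<mu> "\<Inter>n. T n"] by linarith
qed

lemma append_seq_measurable: "append_seq \<sigma> \<in> measurable \<mu> \<mu>"
  unfolding \<mu>_def
proof (rule measurable_PiM_single')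
  fix i :: nat
  show "(\<lambda>Z. append_seq \<sigma> Z i) \<in> measurable (\<Pi>\<^sub>M i\<in>UNIV. uniform_count_measure (UNIV :: bool set))
      (uniform_count_measure UNIV)"
  proof (cases "i < length \<sigma>")
    case True
    then show ?thesis
      by (simp add: append_seq_def space_uniform_count_measure)
  next
    case False
    then show ?thesis
      by (simp add: append_seq_def measurable_component_singleton)
  qed
qed (auto simp: space_uniform_count_measure space_PiM)

lemma above_measurable: "X \<in> sets \<mu> \<Longrightarrow> above X \<sigma> \<in> sets \<mu>"
  using measurable_sets[OF append_seq_measurable, of X \<sigma>] by (simp add: above_def vimage_def)

text \<open>
  The map that replaces the first coordinates of one sequence by those of another, independent one
  preserves the measure. Under it, \<open>X \<inter> cylinder \<sigma>\<close> pulls back to the rectangle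
  \<open>cylinder \<sigma> \<times> above X \<sigma>\<close>.
\<close>

lemma measure_Int_cylinder:
  assumes "X \<in> sets \<mu>"
  shows "measure \<mu> (X \<inter> cylinder \<sigma>) = measure \<mu> (above X \<sigma>) / 2 ^ length \<sigma>"
proof -
  let ?f = "\<lambda>(W, Z). comb_seq (length \<sigma>) W Z"
  interpret sequence_space "uniform_count_measure (UNIV :: bool set)"
    by (intro sequence_space.intro product_prob_spaceI prob_space_coin)
  have f: "?f \<in> measurable (\<mu> \<Otimes>\<^sub>M \<mu>) \<mu>"
    unfolding \<mu>_def by (rule measurable_comb_seq)
  have "comb_seq (length \<sigma>) W Z = append_seq \<sigma> Z" if "W \<in> cylinder \<sigma>" for W Z
    using that by (auto simp: comb_seq_def append_seq_def cylinder_def fun_eq_iff)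
  moreover have "comb_seq (length \<sigma>) W Z \<in> cylinder \<sigma> \<longleftrightarrow> W \<in> cylinder \<sigma>" for W Z
    by (simp add: comb_seq_def cylinder_def)
  moreover have "append_seq \<sigma> Z \<in> cylinder \<sigma>" for Z
    by (simp add: append_seq_def cylinder_def)
  ultimately have pre: "?f -` (X \<inter> cylinder \<sigma>) = cylinder \<sigma> \<times> above X \<sigma>"
    by (auto simp: above_def)
  have "emeasure \<mu> (X \<inter> cylinder \<sigma>) = emeasure (distr (\<mu> \<Otimes>\<^sub>M \<mu>) \<mu> ?f) (X \<inter> cylinder \<sigma>)"
    using PiM_comb_seq[of "length \<sigma>"] by (simp add: \<mu>_def)
  also have "\<dots> = emeasure (\<mu> \<Otimes>\<^sub>M \<mu>) (cylinder \<sigma> \<times> above X \<sigma>)"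
    using assms by (subst emeasure_distr[OF f]) (auto simp: pre space_pair_measure simp del: vimage_Int)
  also have "\<dots> = emeasure \<mu> (cylinder \<sigma>) * emeasure \<mu> (above X \<sigma>)"
    by (intro cantor.emeasure_pair_measure_Times cylinder_measurable above_measurable assms)
  finally show ?thesis
    by (simp add: measure_def enn2real_mult measure_cylinder[unfolded measure_def])
qed

lemma measure_UNIV [simp]: "measure \<mu> UNIV = 1"
  using cantor.prob_space by simp

lemma measure_above_le:
  assumes "X \<in> sets \<mu>"
  shows "measure \<mu> (above X \<sigma>) \<le> 2 ^ length \<sigma> * measure \<mu> X"
proof -
  have "measure \<mu> (X \<inter> cylinder \<sigma>) \<le> measure \<mu> X"
    using assms by (intro cantor.finite_measure_mono) auto
  then show ?thesis
    using measure_Int_cylinder[OF assms, of \<sigma>] by (simp add: divide_le_eq mult.commute)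
qed

lemma above_above: "above (above X \<sigma>) \<tau> = above X (\<sigma> @ \<tau>)"
proof -
  have "append_seq \<sigma> (append_seq \<tau> Z) = append_seq (\<sigma> @ \<tau>) Z" for Z
    by (auto simp: append_seq_def fun_eq_iff nth_append)
  then show ?thesis by (simp add: above_def)
qed

lemma above_Nil [simp]: "above X [] = X"
  by (simp add: above_def append_seq_def)

lemma measure_eq_halves:
  assumes "X \<in> sets \<mu>"
  shows "measure \<mu> X = (measure \<mu> (above X [False]) + measure \<mu> (above X [True])) / 2"
proof -
  have "X = (X \<inter> cylinder [False]) \<union> (X \<inter> cylinder [True])"
    by (auto simp: cylinder_def)
  then have "measure \<mu> X = measure \<mu> ((X \<inter> cylinder [False]) \<union> (X \<inter> cylinder [True]))"
    by simp
  also have "\<dots> = measure \<mu> (X \<inter> cylinder [False]) + measure \<mu> (X \<inter> cylinder [True])"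
    by (intro cantor.finite_measure_Union sets.Int assms cylinder_measurable)
      (auto simp: cylinder_def)
  finally show ?thesis by (simp add: measure_Int_cylinder[OF assms])
qed

lemma martingale_measure_above:
  assumes "X \<in> sets \<mu>"
  shows "martingale (\<lambda>\<sigma>. measure \<mu> (above X \<sigma>))"
  unfolding martingale_def
  by (intro conjI allI measure_nonneg measure_eq_halves[OF above_measurable[OF assms], unfolded above_above])


section \<open>Open sets as sets of sequences with a prefix in a given set\<close>

definition initial :: "cantor \<Rightarrow> nat \<Rightarrow> bool list" where
  "initial Z n = map Z [0..<n]"

text \<open>
  The clopen approximation of \<open>hits P\<close> that looks at prefixes of length \<open>n\<close> only.
\<close>

definition stage :: "(bool list \<Rightarrow> bool) \<Rightarrow> nat \<Rightarrow> cantor set" where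
  "stage P n = {Z. P (initial Z n)}"

definition hits :: "(bool list \<Rightarrow> bool) \<Rightarrow> cantor set" where
  "hits P = {Z. \<exists>n. P (initial Z n)}"

definition extension_closed :: "(bool list \<Rightarrow> bool) \<Rightarrow> bool" where
  "extension_closed P \<longleftrightarrow> (\<forall>\<sigma> \<tau>. P \<sigma> \<longrightarrow> P (\<sigma> @ \<tau>))"

lemma length_initial [simp]: "length (initial Z n) = n"
  by (simp add: initial_def)

lemma take_initial [simp]: "take m (initial Z n) = initial Z (min m n)"
  by (simp add: initial_def take_map min_def)

lemma cylinder_iff_initial: "Z \<in> cylinder \<sigma> \<longleftrightarrow> initial Z (length \<sigma>) = \<sigma>"
  unfolding cylinder_def list_eq_iff_nth_eq[of _ \<sigma>] by (simp add: initial_def)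

lemma initial_append_seq: "initial (append_seq \<sigma> Z) (length \<sigma> + n) = \<sigma> @ initial Z n"
  by (rule nth_equalityI) (auto simp: initial_def append_seq_def nth_append)

lemma strict_prefix_initial_iff: "strict_prefix \<rho> (initial Z n) \<longleftrightarrow> (\<exists>m<n. \<rho> = initial Z m)"
proof
  assume "strict_prefix \<rho> (initial Z n)"
  then have "length \<rho> < n" "\<rho> = take (length \<rho>) (initial Z n)"
    using prefix_length_less[of \<rho> "initial Z n"]
    by (auto simp: strict_prefix_def prefix_def simp del: take_initial)
  then show "\<exists>m<n. \<rho> = initial Z m"
    by (intro exI[of _ "length \<rho>"]) (simp add: min_def)
next
  assume "\<exists>m<n. \<rho> = initial Z m"
  then obtain m where "m < n" "\<rho> = take m (initial Z n)" by (auto simp: min_def)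
  then show "strict_prefix \<rho> (initial Z n)"
    by (metis length_initial length_take min.absorb4 nat_neq_iff strict_prefix_def take_is_prefix)
qed

lemma generated_eq_hits: "generated U = hits (\<lambda>\<sigma>. \<sigma> \<in> U)"
proof (intro set_eqI iffI)
  fix Z assume "Z \<in> hits (\<lambda>\<sigma>. \<sigma> \<in> U)"
  then obtain n where "initial Z n \<in> U" by (auto simp: hits_def)
  then show "Z \<in> generated U"
    unfolding generated_def by (intro UN_I[of "initial Z n"]) (auto simp: cylinder_iff_initial)
next
  fix Z assume "Z \<in> generated U"
  then obtain \<sigma> where "\<sigma> \<in> U" "initial Z (length \<sigma>) = \<sigma>"
    by (auto simp: generated_def cylinder_iff_initial)
  then show "Z \<in> hits (\<lambda>\<sigma>. \<sigma> \<in> U)" unfolding hits_def by (metis mem_Collect_eq)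
qed

lemma hits_eq_generated: "hits P = generated {\<sigma>. P \<sigma>}"
  by (simp add: generated_eq_hits)

lemma open_hits: "open (hits P)"
  unfolding hits_eq_generated generated_def by (intro open_UN ballI open_cylinder)

lemma hits_measurable [measurable]: "hits P \<in> sets \<mu>"
  unfolding hits_eq_generated generated_def
  by (rule sets.countable_UN'') (auto intro: cylinder_measurable)

lemma hits_Un: "hits P \<union> hits Q = hits (\<lambda>\<sigma>. P \<sigma> \<or> Q \<sigma>)"
  by (auto simp: hits_def)

lemma stage_eq: "stage P n = (\<Union>\<tau>\<in>{\<tau>. length \<tau> = n \<and> P \<tau>}. cylinder \<tau>)"
proof (intro set_eqI iffI)
  fix Z assume "Z \<in> stage P n"
  then show "Z \<in> (\<Union>\<tau>\<in>{\<tau>. length \<tau> = n \<and> P \<tau>}. cylinder \<tau>)"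
    by (intro UN_I[of "initial Z n"]) (auto simp: stage_def cylinder_iff_initial)
next
  fix Z assume "Z \<in> (\<Union>\<tau>\<in>{\<tau>. length \<tau> = n \<and> P \<tau>}. cylinder \<tau>)"
  then obtain \<tau> where "length \<tau> = n" "P \<tau>" "initial Z (length \<tau>) = \<tau>"
    by (force simp: cylinder_iff_initial)
  then show "Z \<in> stage P n" by (simp add: stage_def)
qed

lemma stage_measurable [measurable]: "stage P n \<in> sets \<mu>"
  unfolding stage_eq by (rule sets.countable_UN'') (auto intro: cylinder_measurable)

lemma measure_stage: "measure \<mu> (stage P n) = card {\<tau>. length \<tau> = n \<and> P \<tau>} / 2 ^ n"
proof -
  have "measure \<mu> (stage P n) = (\<Sum>\<tau> | length \<tau> = n \<and> P \<tau>. measure \<mu> (cylinder \<tau>))"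
    unfolding stage_eq
    by (rule cantor.finite_measure_finite_Union[OF finite_strings])
      (use cylinder_iff_initial in \<open>fastforce simp: disjoint_family_on_def
        intro: cylinder_measurable\<close>)+
  also have "\<dots> = card {\<tau>. length \<tau> = n \<and> P \<tau>} / 2 ^ n"
    by (simp add: measure_cylinder)
  finally show ?thesis .
qed

lemma hits_eq_Union_stage: "hits P = (\<Union>n. stage P n)"
  by (auto simp: hits_def stage_def)

lemma stage_mono:
  assumes "extension_closed P" "m \<le> n"
  shows "stage P m \<subseteq> stage P n"
proof
  fix Z assume "Z \<in> stage P m"
  moreover have "initial Z n = initial Z m @ drop m (initial Z n)"
    using append_take_drop_id[of m "initial Z n"] assms(2) by (simp add: min_def)
  ultimately show "Z \<in> stage P n"
    using assms(1) unfolding extension_closed_def stage_def by (metis mem_Collect_eq)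
qed

lemma stage_subset_hits: "stage P n \<subseteq> hits P"
  by (auto simp: hits_def stage_def)

lemma measure_stage_tendsto:
  assumes "extension_closed P"
  shows "(\<lambda>n. measure \<mu> (stage P n)) \<longlonglongrightarrow> measure \<mu> (hits P)"
  unfolding hits_eq_Union_stage
  by (rule cantor.finite_Lim_measure_incseq)
    (auto simp: incseq_def intro: subsetD[OF stage_mono[OF assms]] stage_measurable)

lemma above_stage: "above (stage P (length \<sigma> + n)) \<sigma> = stage (\<lambda>\<tau>. P (\<sigma> @ \<tau>)) n"
  by (simp add: above_def stage_def initial_append_seq)

text \<open>
  The hypothesis covers both situations of interest: \<open>P\<close> is inherited by extensions, or \<open>P\<close> fails on
  every proper prefix of \<open>\<sigma>\<close>.
\<close>

lemma above_hits:
  assumes "\<And>\<rho>. strict_prefix \<rho> \<sigma> \<Longrightarrow> P \<rho> \<Longrightarrow> P \<sigma>"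
  shows "above (hits P) \<sigma> = hits (\<lambda>\<tau>. P (\<sigma> @ \<tau>))"
proof (intro set_eqI iffI)
  fix Z assume "Z \<in> above (hits P) \<sigma>"
  then obtain n where n: "P (initial (append_seq \<sigma> Z) n)" by (auto simp: above_def hits_def)
  show "Z \<in> hits (\<lambda>\<tau>. P (\<sigma> @ \<tau>))"
  proof (cases "n < length \<sigma>")
    case True
    then have "strict_prefix (initial (append_seq \<sigma> Z) n) \<sigma>"
      using strict_prefix_initial_iff[of "initial (append_seq \<sigma> Z) n" "append_seq \<sigma> Z" "length \<sigma>"]
        initial_append_seq[of \<sigma> Z 0] by (auto simp: initial_def)
    from assms[OF this n] have "P (\<sigma> @ initial Z 0)" by (simp add: initial_def)
    then show ?thesis unfolding hits_def by blast
  next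
    case False
    then have "P (\<sigma> @ initial Z (n - length \<sigma>))"
      using n initial_append_seq[of \<sigma> Z "n - length \<sigma>"] by simp
    then show ?thesis unfolding hits_def by blast
  qed
next
  fix Z assume "Z \<in> hits (\<lambda>\<tau>. P (\<sigma> @ \<tau>))"
  then show "Z \<in> above (hits P) \<sigma>"
    unfolding above_def hits_def by (auto simp flip: initial_append_seq)
qed

lemma above_hits_extension_closed:
  "extension_closed P \<Longrightarrow> above (hits P) \<sigma> = hits (\<lambda>\<tau>. P (\<sigma> @ \<tau>))"
  by (rule above_hits) (auto simp: extension_closed_def strict_prefix_def prefix_def)

lemma extension_closed_append: "extension_closed P \<Longrightarrow> extension_closed (\<lambda>\<tau>. P (\<sigma> @ \<tau>))"
  unfolding extension_closed_def by (metis append_assoc)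

lemma above_hits_eq_UNIV:
  assumes "prefix \<rho> \<sigma>" "P \<rho>"
  shows "above (hits P) \<sigma> = UNIV"
proof -
  have "initial (append_seq \<sigma> Z) (length \<rho>) = \<rho>" for Z
  proof -
    have "initial (append_seq \<sigma> Z) (length \<sigma>) = \<sigma>"
      using initial_append_seq[of \<sigma> Z 0] by (simp add: initial_def)
    then have "take (length \<rho>) (initial (append_seq \<sigma> Z) (length \<sigma>)) = \<rho>"
      using assms(1) by (auto simp: prefix_def simp del: take_initial)
    then show ?thesis
      using assms(1) by (simp add: prefix_length_le min_absorb1)
  qed
  then show ?thesis
    using assms(2) unfolding above_def hits_def by (metis (mono_tags, lifting) UNIV_eq_I mem_Collect_eq)
qed

lemma hits_minimal_strings: "hits (\<lambda>\<sigma>. \<sigma> \<in> minimal_strings P) = hits P"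
proof (intro set_eqI iffI)
  fix Z assume "Z \<in> hits P"
  then have ex: "\<exists>n. P (initial Z n)" by (simp add: hits_def)
  define n where "n = (LEAST n. P (initial Z n))"
  have "P (initial Z n)" "\<And>m. m < n \<Longrightarrow> \<not> P (initial Z m)"
    unfolding n_def using LeastI_ex[OF ex] not_less_Least by blast+
  then have "initial Z n \<in> minimal_strings P"
    by (auto simp: minimal_strings_def strict_prefix_initial_iff)
  then show "Z \<in> hits (\<lambda>\<sigma>. \<sigma> \<in> minimal_strings P)" unfolding hits_def by blast
qed (auto simp: hits_def minimal_strings_def)

lemma generated_minimal_strings: "generated (minimal_strings P) = hits P"
  by (simp add: generated_eq_hits hits_minimal_strings)

lemma prefix_free_minimal_strings: "prefix_free (minimal_strings P)"
  by (auto simp: prefix_free_def minimal_strings_def)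


section \<open>Ville's inequality\<close>

lemma martingale_above: "martingale d \<Longrightarrow> martingale (\<lambda>\<tau>. d (\<sigma> @ \<tau>))"
  unfolding martingale_def by (metis append_assoc)

text \<open>
  By induction on the number of steps, splitting at the first bit: if \<open>d []\<close> is below \<open>q\<close>, the set seen
  after a first bit \<open>b\<close> is the one for the martingale \<open>\<lambda>\<sigma>. d (b # \<sigma>)\<close>, and the two bounds average to
  \<open>d [] / q\<close>.
\<close>

lemma Ville_finite:
  assumes "q > 0" "martingale d"
  shows "measure \<mu> (\<Union>k\<le>n. stage (\<lambda>\<sigma>. d \<sigma> \<ge> q) k) \<le> d [] / q"
  using assms(2)
proof (induction n arbitrary: d)
  case 0
  have "stage (\<lambda>\<sigma>. d \<sigma> \<ge> q) 0 = (if d [] \<ge> q then UNIV else {})"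
    by (simp add: stage_def initial_def)
  moreover have "d [] \<ge> 0" using 0 by (simp add: martingale_def)
  ultimately show ?case using assms(1) by (simp add: le_divide_eq cantor.prob_space[simplified])
next
  case (Suc n)
  let ?X = "\<Union>k\<le>Suc n. stage (\<lambda>\<sigma>. d \<sigma> \<ge> q) k"
  show ?case
  proof (cases "d [] \<ge> q")
    case True
    then have "1 \<le> d [] / q" using assms(1) by (simp add: le_divide_eq)
    then show ?thesis using cantor.prob_le_1[of ?X] by linarith
  next
    case False
    have above: "above ?X [b] = (\<Union>k\<le>n. stage (\<lambda>\<sigma>. d ([b] @ \<sigma>) \<ge> q) k)" for b
    proof -
      have "above ?X [b] = (\<Union>k\<le>Suc n. above (stage (\<lambda>\<sigma>. d \<sigma> \<ge> q) k) [b])"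
        by (auto simp: above_def)
      also have "\<dots> = above (stage (\<lambda>\<sigma>. d \<sigma> \<ge> q) 0) [b]
          \<union> (\<Union>k\<le>n. above (stage (\<lambda>\<sigma>. d \<sigma> \<ge> q) (length [b] + k)) [b])"
        unfolding atMost_Suc_eq_insert_0 by (simp add: image_image)
      also have "above (stage (\<lambda>\<sigma>. d \<sigma> \<ge> q) 0) [b] = {}"
        using False by (simp add: above_def stage_def initial_def)
      finally show ?thesis by (simp only: above_stage Un_empty_left)
    qed
    have "measure \<mu> (above ?X [b]) \<le> d [b] / q" for b
      unfolding above using Suc.IH[OF martingale_above[OF Suc.prems, of "[b]"]] by simp
    moreover have "?X \<in> sets \<mu>" by (intro sets.finite_UN) auto
    note measure_eq_halves[OF this]
    moreover have "d [] = (d [False] + d [True]) / 2"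
      using Suc.prems unfolding martingale_def by (metis append_Nil)
    then have "d [] / q = (d [False] / q + d [True] / q) / 2"
      by (simp add: add_divide_distrib)
    ultimately show ?thesis by (smt (verit) divide_right_mono)
  qed
qed

lemma Ville:
  assumes "q > 0" "martingale d"
  shows "measure \<mu> (hits (\<lambda>\<sigma>. d \<sigma> \<ge> q)) \<le> d [] / q"
proof (rule LIMSEQ_le_const2)
  have "(\<Union>n. \<Union>k\<le>n. stage (\<lambda>\<sigma>. d \<sigma> \<ge> q) k) = hits (\<lambda>\<sigma>. d \<sigma> \<ge> q)"
    unfolding hits_eq_Union_stage by auto
  moreover have "(\<lambda>n. measure \<mu> (\<Union>k\<le>n. stage (\<lambda>\<sigma>. d \<sigma> \<ge> q) k))
      \<longlonglongrightarrow> measure \<mu> (\<Union>n. \<Union>k\<le>n. stage (\<lambda>\<sigma>. d \<sigma> \<ge> q) k)"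
    by (rule cantor.finite_Lim_measure_incseq)
      (auto intro!: sets.finite_UN incseq_SucI simp: atMost_Suc)
  ultimately show "(\<lambda>n. measure \<mu> (\<Union>k\<le>n. stage (\<lambda>\<sigma>. d \<sigma> \<ge> q) k))
      \<longlonglongrightarrow> measure \<mu> (hits (\<lambda>\<sigma>. d \<sigma> \<ge> q))" by simp
qed (use Ville_finite[OF assms] in auto)

lemma Ville_above:
  assumes "q > 0" "martingale d" and "\<And>\<rho>. strict_prefix \<rho> \<sigma> \<Longrightarrow> d \<rho> < q"
  shows "measure \<mu> (above (hits (\<lambda>\<sigma>. d \<sigma> \<ge> q)) \<sigma>) \<le> d \<sigma> / q"
proof -
  have "above (hits (\<lambda>\<sigma>. d \<sigma> \<ge> q)) \<sigma> = hits (\<lambda>\<tau>. d (\<sigma> @ \<tau>) \<ge> q)"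
    using assms(3) by (intro above_hits) (auto simp: not_less[symmetric])
  then show ?thesis using Ville[OF assms(1) martingale_above[OF assms(2), of \<sigma>]] by simp
qed


section \<open>C.e. open sets\<close>

lemma minimal_strings_iff: "\<sigma> \<in> minimal_strings P \<longleftrightarrow> P \<sigma> \<and> \<not> (\<exists>m<length \<sigma>. P (take m \<sigma>))"
proof -
  have "strict_prefix \<tau> \<sigma> \<longleftrightarrow> (\<exists>m<length \<sigma>. \<tau> = take m \<sigma>)" for \<tau>
  proof
    assume "strict_prefix \<tau> \<sigma>"
    then obtain \<rho> where "\<sigma> = \<tau> @ \<rho>" "\<rho> \<noteq> []"
      by (auto simp: strict_prefix_def prefix_def)
    then show "\<exists>m<length \<sigma>. \<tau> = take m \<sigma>" by (intro exI[of _ "length \<tau>"]) simp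
  next
    assume "\<exists>m<length \<sigma>. \<tau> = take m \<sigma>"
    then show "strict_prefix \<tau> \<sigma>"
      by (auto simp: strict_prefix_def take_is_prefix)
  qed
  then show ?thesis unfolding minimal_strings_def by auto
qed

text \<open>
  The minimal strings with a computable property form a prefix-free set that is even decidable, so
  stage \<open>s\<close> may simply test the string with code \<open>s\<close>.
\<close>

lemma ce_open_hits:
  assumes P: "computable P"
  shows "ce_open (hits P)"
proof -
  define f where "f s = (if string_of s \<in> minimal_strings P then Suc s else 0)" for s
  have "computable f"
    unfolding f_def minimal_strings_iff by (intro computable_intros computable_comp[OF P])
  then obtain F where "recursive 1 F" and F: "\<And>s. F [s] = f s"
    unfolding computable_nat1_iff by blast
  moreover have "minimal_strings P = {\<sigma>. \<exists>s. F [s] = Suc (str_code \<sigma>)}"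
  proof -
    have "f s = Suc (str_code \<sigma>) \<longleftrightarrow> s = str_code \<sigma> \<and> \<sigma> \<in> minimal_strings P" for s \<sigma>
      by (cases "s = str_code \<sigma>") (simp_all add: f_def)
    then show ?thesis unfolding F by simp
  qed
  ultimately have "ce_strings (minimal_strings P)"
    unfolding ce_strings_def by blast
  then show ?thesis
    unfolding ce_open_def generated_minimal_strings[symmetric]
    using prefix_free_minimal_strings by blast
qed

text \<open>
  Enumeration becomes decidable by delaying it: \<open>\<tau>\<close> is accepted if one of its prefixes has been
  enumerated within \<open>length \<tau>\<close> stages. Every sequence through an enumerated string has prefixes long
  enough to be accepted.
\<close>

lemma enumerated_eq_hits:
  fixes f :: "nat \<Rightarrow> nat"
  assumes "computable f"
  obtains P where "computable P" "extension_closed P"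
    "generated {\<sigma>. \<exists>s. f s = Suc (str_code \<sigma>)} = hits P"
proof
  let ?P = "\<lambda>\<tau>. \<exists>s<Suc (length \<tau>). \<exists>j<Suc (length \<tau>). f s = Suc (str_code (take j \<tau>))"
  show "computable ?P"
    by (intro computable_intros computable_comp[OF assms])
  show "extension_closed ?P"
    unfolding extension_closed_def
  proof (intro allI impI)
    fix \<sigma> \<tau> assume "?P \<sigma>"
    then obtain s j where "s < Suc (length \<sigma>)" "j < Suc (length \<sigma>)" "f s = Suc (str_code (take j \<sigma>))"
      by blast
    then show "?P (\<sigma> @ \<tau>)"
      by (intro exI[of _ s] exI[of _ j] conjI) auto
  qed
  show "generated {\<sigma>. \<exists>s. f s = Suc (str_code \<sigma>)} = hits ?P"
  proof (intro set_eqI iffI)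
    fix Z assume "Z \<in> generated {\<sigma>. \<exists>s. f s = Suc (str_code \<sigma>)}"
    then obtain s k where "f s = Suc (str_code (initial Z k))"
      by (auto simp: generated_eq_hits hits_def)
    then have "?P (initial Z (max s k))"
      by (intro exI[of _ s] exI[of _ k] conjI) auto
    then show "Z \<in> hits ?P" unfolding hits_def by blast
  next
    fix Z assume "Z \<in> hits ?P"
    then show "Z \<in> generated {\<sigma>. \<exists>s. f s = Suc (str_code \<sigma>)}"
      by (auto simp: generated_eq_hits hits_def)
  qed
qed

lemma ce_openE:
  assumes "ce_open X"
  obtains P where "computable P" "extension_closed P" "X = hits P"
proof -
  obtain F where "recursive 1 F" and X: "X = generated {\<sigma>. \<exists>s. F [s] = Suc (str_code \<sigma>)}"
    using assms unfolding ce_open_def ce_strings_def by blast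
  then have "computable (\<lambda>s. F [s])"
    unfolding computable_nat1_iff by blast
  from enumerated_eq_hits[OF this] that X show ?thesis by metis
qed

lemma uniformly_ce_open_imp_ce_open:
  assumes "uniformly_ce_open X"
  shows "ce_open (X n)"
proof -
  obtain F where "recursive 2 F" and X: "X n = generated {\<sigma>. \<exists>s. F [n, s] = Suc (str_code \<sigma>)}"
    using assms unfolding uniformly_ce_open_def uniformly_ce_strings_def by metis
  then have "computable (\<lambda>p. F [fst p, snd p])"
    unfolding computable_nat2_iff by auto
  from computable_comp2[OF this computable_const computable_id]
  have "computable (\<lambda>s. F [n, s])" .
  from enumerated_eq_hits[OF this] X ce_open_hits show ?thesis by metis
qed

lemma ce_open_measurable: "ce_open X \<Longrightarrow> X \<in> sets \<mu>"
  by (auto elim: ce_openE)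

lemma ce_open_open: "ce_open X \<Longrightarrow> open X"
  by (auto elim: ce_openE simp: open_hits)

text \<open>
  The union of two prefix-free sets of strings need not be prefix-free; the description by computable
  properties of prefixes hides this.
\<close>

lemma ce_open_Un:
  assumes "ce_open X" "ce_open Y"
  shows "ce_open (X \<union> Y)"
proof -
  obtain P Q where PQ: "computable P" "X = hits P" "computable Q" "Y = hits Q"
    using assms by (metis ce_openE)
  then show ?thesis
    unfolding PQ hits_Un by (intro ce_open_hits computable_intros)
qed

lemma ce_open_above:
  assumes "ce_open X"
  shows "ce_open (above X \<sigma>)"
proof -
  obtain P where P: "computable P" "extension_closed P" "X = hits P"
    using assms by (rule ce_openE)
  then show ?thesis
    by (simp add: above_hits_extension_closed)
      (intro ce_open_hits computable_comp[OF P(1)] computable_intros)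
qed

lemma bounded_open_iff: "ce_open X \<Longrightarrow> bounded_open X \<longleftrightarrow> measure \<mu> X < 1"
  by (simp add: bounded_open_def ce_open_open)

text \<open>
  If \<open>R n \<sigma>\<close> says that step \<open>n\<close> finds a fact about \<open>\<sigma>\<close>, the property on the right is decidable whenever
  \<open>R\<close> is: the length of \<open>\<tau>\<close> serves as the step at which all its prefixes are examined.
\<close>

lemma cylinder_subset_hits_Ex:
  assumes "\<exists>n\<ge>length \<sigma>. R n \<sigma>"
  shows "cylinder \<sigma> \<subseteq> hits (\<lambda>\<tau>. \<exists>k<Suc (length \<tau>). R (length \<tau>) (take k \<tau>))"
proof
  fix Z assume Z: "Z \<in> cylinder \<sigma>"
  obtain n where n: "n \<ge> length \<sigma>" "R n \<sigma>" using assms by blast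
  then have "R (length (initial Z n)) (take (length \<sigma>) (initial Z n))"
    using Z by (simp add: cylinder_iff_initial min_absorb1)
  then have "\<exists>k<Suc (length (initial Z n)). R (length (initial Z n)) (take k (initial Z n))"
    using n(1) by (intro exI[of _ "length \<sigma>"]) auto
  then show "Z \<in> hits (\<lambda>\<tau>. \<exists>k<Suc (length \<tau>). R (length \<tau>) (take k \<tau>))"
    unfolding hits_def by blast
qed

text \<open>
  With rational \<open>q\<close> strictly between \<open>\<mu> X\<close> and \<open>1\<close>, the inequality \<open>\<mu> (above X \<sigma>) > q\<close> holds exactly if
  it holds for some stage of \<open>X\<close> above \<open>\<sigma>\<close>, which counting detects. Ville's inequality for the martingale
  \<open>\<lambda>\<sigma>. \<mu> (above X \<sigma>)\<close> bounds the measure of the set generated by these strings by \<open>\<mu> X / q\<close>.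
\<close>

lemma ce_superset_of_density_points:
  assumes "ce_open X" "measure \<mu> X < 1"
  shows "\<exists>V. ce_open V \<and> measure \<mu> V < 1 \<and> (\<forall>\<sigma>. measure \<mu> (above X \<sigma>) = 1 \<longrightarrow> cylinder \<sigma> \<subseteq> V)"
proof -
  obtain P where P: "computable P" "extension_closed P" and X: "X = hits P"
    using assms(1) by (rule ce_openE)
  obtain q where "q \<in> \<rat>" "measure \<mu> X < q" "q < 1"
    using Rats_dense_in_real[OF assms(2)] by blast
  then have "q > 0" using measure_nonneg[of \<mu> X] by linarith
  obtain u v :: nat where v: "v > 0" and q: "q = u / v"
    using Rats_abs_nat_div_natE[OF \<open>q \<in> \<rat>\<close>] \<open>q > 0\<close> by (metis abs_of_pos gr0I)
  \<comment> \<open>the comparison of \<open>u / v\<close> with a measure, cleared of denominators\<close>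
  define R where "R n \<sigma> \<longleftrightarrow> u * 2 ^ n < v * card {\<tau>. length \<tau> = n \<and> P (\<sigma> @ \<tau>)}" for n \<sigma>
  have R_iff: "R n \<sigma> \<longleftrightarrow> q < measure \<mu> (stage (\<lambda>\<tau>. P (\<sigma> @ \<tau>)) n)" for n \<sigma>
  proof -
    have "q < measure \<mu> (stage (\<lambda>\<tau>. P (\<sigma> @ \<tau>)) n)
        \<longleftrightarrow> real (u * 2 ^ n) < real (v * card {\<tau>. length \<tau> = n \<and> P (\<sigma> @ \<tau>)})"
      using v by (simp add: measure_stage q field_simps)
    then show ?thesis unfolding R_def of_nat_less_iff by simp
  qed
  let ?V = "hits (\<lambda>\<tau>. \<exists>k<Suc (length \<tau>). R (length \<tau>) (take k \<tau>))"
  let ?d = "\<lambda>\<sigma>. measure \<mu> (above X \<sigma>)"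
  have "ce_open ?V"
    unfolding R_def
    by (intro ce_open_hits computable_intros computable_comp[OF P(1)])
  moreover have "?V \<subseteq> hits (\<lambda>\<sigma>. ?d \<sigma> \<ge> q)"
  proof
    fix Z assume "Z \<in> ?V"
    then obtain n k where "k \<le> n" "R n (initial Z k)"
      by (auto simp: hits_def min_def less_Suc_eq_le)
    then have "q < measure \<mu> (stage (\<lambda>\<tau>. P (initial Z k @ \<tau>)) n)"
      by (simp add: R_iff)
    also have "\<dots> \<le> ?d (initial Z k)"
      unfolding X above_hits_extension_closed[OF P(2)]
      by (intro cantor.finite_measure_mono stage_subset_hits hits_measurable)
    finally show "Z \<in> hits (\<lambda>\<sigma>. ?d \<sigma> \<ge> q)"
      unfolding hits_def by (auto intro: less_imp_le)
  qed
  then have "measure \<mu> ?V \<le> measure \<mu> (hits (\<lambda>\<sigma>. ?d \<sigma> \<ge> q))"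
    by (intro cantor.finite_measure_mono hits_measurable)
  then have "measure \<mu> ?V \<le> measure \<mu> X / q"
    using Ville[OF \<open>q > 0\<close> martingale_measure_above, of X] ce_open_measurable[OF assms(1)] by simp
  then have "measure \<mu> ?V < 1"
    using \<open>measure \<mu> X < q\<close> \<open>q > 0\<close> by (smt (verit) divide_less_eq_1_pos)
  moreover have "cylinder \<sigma> \<subseteq> ?V" if "?d \<sigma> = 1" for \<sigma>
  proof (rule cylinder_subset_hits_Ex)
    have "(\<lambda>n. measure \<mu> (stage (\<lambda>\<tau>. P (\<sigma> @ \<tau>)) n)) \<longlonglongrightarrow> 1"
      using measure_stage_tendsto[OF extension_closed_append[OF P(2)], of \<sigma>] that
      by (simp add: X above_hits_extension_closed[OF P(2)])
    from order_tendstoD(1)[OF this \<open>q < 1\<close>]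
    have "\<forall>\<^sub>F n in sequentially. R n \<sigma>" by (simp add: R_iff)
    then show "\<exists>n\<ge>length \<sigma>. R n \<sigma>"
      using eventually_ge_at_top[of "length \<sigma>"] eventually_happens'[OF sequentially_bot eventually_conj]
      by blast
  qed
  ultimately show ?thesis by blast
qed

text \<open>
  In (P2) the inclusion \<open>U \<subseteq> V\<close> is a special case of the condition on cylinders: a sequence in \<open>X\<close> has a
  prefix whose cylinder lies in \<open>X\<close>.
\<close>

lemma subset_if_contains_full_cylinders:
  assumes "ce_open X" "\<forall>\<sigma>. measure \<mu> (above X \<sigma>) = 1 \<longrightarrow> cylinder \<sigma> \<subseteq> V"
  shows "X \<subseteq> V"
proof
  fix Z assume "Z \<in> X"
  obtain P where X: "X = hits P"
    using assms(1) by (rule ce_openE)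
  obtain n where "P (initial Z n)" using \<open>Z \<in> X\<close> by (auto simp: X hits_def)
  then have "above X (initial Z n) = UNIV"
    unfolding X by (intro above_hits_eq_UNIV[OF prefix_order.refl])
  then have "cylinder (initial Z n) \<subseteq> V" using assms(2) by simp
  then show "Z \<in> V" by (auto simp: cylinder_iff_initial)
qed

text \<open>
  The measure of \<open>T n\<close> above \<open>\<sigma>\<close> is at most \<open>2 ^ length \<sigma> / 2 ^ n\<close>, so large \<open>n\<close> preserve both strict
  inequalities.
\<close>

lemma small_enough_test_component:
  assumes X: "X \<in> sets \<mu>" "measure \<mu> X < 1" "measure \<mu> (above X \<sigma>) < 1"
    and T: "\<And>n. T n \<in> sets \<mu>" "\<And>n. measure \<mu> (T n) \<le> 1 / 2 ^ n"
  shows "\<exists>n. measure \<mu> (X \<union> T n) < 1 \<and> measure \<mu> (above (X \<union> T n) \<sigma>) < 1"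
proof -
  define \<delta> where "\<delta> = min (1 - measure \<mu> X) (1 - measure \<mu> (above X \<sigma>))"
  have "\<delta> / 2 ^ length \<sigma> > 0" using X by (simp add: \<delta>_def)
  then obtain n where n: "(1 / 2) ^ n < \<delta> / 2 ^ length \<sigma>"
    using real_arch_pow_inv[of _ "1 / 2"] by auto
  then have small: "2 ^ length \<sigma> * (1 / 2 ^ n) < \<delta>"
    by (simp add: field_simps power_divide)
  have "measure \<mu> (X \<union> T n) \<le> measure \<mu> X + measure \<mu> (T n)"
    by (intro measure_Un_le X T)
  moreover have "measure \<mu> (T n) \<le> 2 ^ length \<sigma> * (1 / 2 ^ n)"
    using T(2)[of n] mult_right_mono[of 1 "2 ^ length \<sigma>" "1 / 2 ^ n :: real"] by simp
  moreover have "above (X \<union> T n) \<sigma> = above X \<sigma> \<union> above (T n) \<sigma>"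
    by (auto simp: above_def)
  then have "measure \<mu> (above (X \<union> T n) \<sigma>) \<le> measure \<mu> (above X \<sigma>) + measure \<mu> (above (T n) \<sigma>)"
    using measure_Un_le[OF above_measurable[OF X(1)] above_measurable[OF T(1)]]
    by simp
  moreover have "measure \<mu> (above (T n) \<sigma>) \<le> 2 ^ length \<sigma> * (1 / 2 ^ n)"
    using measure_above_le[OF T(1)] T(2) by (meson mult_left_mono order_trans zero_le_power zero_le_numeral)
  ultimately show ?thesis
    using small unfolding \<delta>_def by (intro exI[of _ n]) linarith
qed


section \<open>Schnorr open sets\<close>

text \<open>
  The measure of \<open>stage P (N k)\<close> is a fraction with denominator \<open>2 ^ N k\<close> and approximates the measure
  of \<open>hits P\<close> to within \<open>1 / 2 ^ k\<close>.
\<close>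

lemma schnorr_openI:
  assumes P: "computable P" and N: "computable N"
    and modulus: "\<And>k. measure \<mu> (hits P - stage P (N k)) \<le> 1 / 2 ^ k"
  shows "schnorr_open (hits P)"
proof -
  define a where "a k = card {\<tau>. length \<tau> = N k \<and> P \<tau>}" for k
  define c where "c k = 2 ^ N k - (1::nat)" for k
  have "computable a" "computable c"
    unfolding a_def c_def
    by (intro computable_intros computable_comp[OF P] computable_comp[OF N] N)+
  then obtain A B C where "recursive 1 A" "recursive 1 B" "recursive 1 C"
    and eq: "\<And>k. A [k] = a k" "\<And>k. B [k] = 0" "\<And>k. C [k] = c k"
    using computable_const[of "0::nat", where ?'a = nat] unfolding computable_nat1_iff by metis
  moreover have "\<bar>measure \<mu> (hits P) - (real (A [k]) - real (B [k])) / real (Suc (C [k]))\<bar> \<le> 1 / 2 ^ k"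
    for k
  proof -
    have "(real (A [k]) - real (B [k])) / real (Suc (C [k])) = measure \<mu> (stage P (N k))"
      by (simp add: eq a_def c_def measure_stage of_nat_diff)
    moreover have "measure \<mu> (hits P - stage P (N k)) = measure \<mu> (hits P) - measure \<mu> (stage P (N k))"
      by (intro cantor.finite_measure_Diff hits_measurable stage_measurable stage_subset_hits)
    ultimately show ?thesis
      using modulus[of k] measure_nonneg[of \<mu> "hits P - stage P (N k)"] by linarith
  qed
  ultimately have "computable_real (measure \<mu> (hits P))"
    unfolding computable_real_def by blast
  then show ?thesis
    unfolding schnorr_open_def using ce_open_hits[OF P] by blast
qed

text \<open>
  The measures of the stages converge to \<open>\<mu> X\<close> from below, so searching for a stage whose measure is
  close to a good rational approximation of \<open>\<mu> X\<close> succeeds, and gives a modulus of convergence.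
\<close>

lemma schnorr_openE:
  assumes "schnorr_open X"
  obtains P N where "computable P" "extension_closed P" "X = hits P" "computable N"
    "\<And>k. measure \<mu> (hits P - stage P (N k)) \<le> 1 / 2 ^ k"
proof -
  obtain P where P: "computable P" "extension_closed P" "X = hits P"
    using assms unfolding schnorr_open_def by (blast elim: ce_openE)
  obtain A B C where "recursive 1 A" "recursive 1 B" "recursive 1 C"
    and approx: "\<And>n. \<bar>measure \<mu> X - (real (A [n]) - real (B [n])) / real (Suc (C [n]))\<bar> \<le> 1 / 2 ^ n"
    using assms unfolding schnorr_open_def computable_real_def by blast
  define a b c where "a n = A [n]" and "b n = B [n]" and "c n = C [n]" for n
  have comp: "computable a" "computable b" "computable c"
    unfolding a_def b_def c_def computable_nat1_iff
    using \<open>recursive 1 A\<close> \<open>recursive 1 B\<close> \<open>recursive 1 C\<close> by blast+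
  define r where "r k = (real (a k) - real (b k)) / real (Suc (c k))" for k
  have r: "\<bar>measure \<mu> X - r k\<bar> \<le> 1 / 2 ^ k" for k
    using approx[of k] unfolding r_def a_def b_def c_def .
  \<comment> \<open>the inequality of \<open>close_iff\<close>, cleared of denominators; at precision \<open>k + 2\<close> it costs
      \<open>1 / 2 ^ (k + 2) + 1 / 2 ^ (k + 1)\<close> in total, and stages within \<open>1 / 2 ^ (k + 2)\<close> of \<open>\<mu> X\<close> satisfy it\<close>
  define close where "close n k \<longleftrightarrow>
      a (k + 2) * (2 ^ n * 2 ^ (k + 1)) \<le> b (k + 2) * (2 ^ n * 2 ^ (k + 1)) +
        Suc (c (k + 2)) * (card {\<tau>. length \<tau> = n \<and> P \<tau>} * 2 ^ (k + 1) + 2 ^ n)" for n k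
  have close_iff: "close n k \<longleftrightarrow> r (k + 2) \<le> measure \<mu> (stage P n) + 1 / 2 ^ (k + 1)" for n k
  proof -
    have arith: "(x - y) / z \<le> m / s + 1 / t \<longleftrightarrow> x * (s * t) \<le> y * (s * t) + z * (m * t + s)"
      if "z > 0" "s > 0" "t > 0" for x y z m s t :: real
      using that by (simp add: divide_simps) (simp add: algebra_simps)
    have "close n k \<longleftrightarrow> real (a (k + 2) * (2 ^ n * 2 ^ (k + 1))) \<le> real (b (k + 2) * (2 ^ n * 2 ^ (k + 1)) +
        Suc (c (k + 2)) * (card {\<tau>. length \<tau> = n \<and> P \<tau>} * 2 ^ (k + 1) + 2 ^ n))"
      unfolding close_def of_nat_le_iff ..
    also have "\<dots> \<longleftrightarrow> r (k + 2) \<le> measure \<mu> (stage P n) + 1 / 2 ^ (k + 1)"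
      unfolding r_def measure_stage by (subst arith) (auto simp: algebra_simps)
    finally show ?thesis .
  qed
  define N where "N k = (LEAST n. close n k)" for k
  have ex: "\<exists>n. close n k" for k
  proof -
    have "(\<lambda>n. measure \<mu> (stage P n)) \<longlonglongrightarrow> measure \<mu> X"
      using measure_stage_tendsto[OF P(2)] P(3) by simp
    from order_tendstoD(1)[OF this, of "measure \<mu> X - 1 / 2 ^ (k + 2)"]
    obtain n where "measure \<mu> X - 1 / 2 ^ (k + 2) < measure \<mu> (stage P n)"
      by (auto simp: eventually_sequentially)
    then show ?thesis
      using r[of "k + 2"] by (intro exI[of _ n]) (auto simp: close_iff)
  qed
  have "computable N"
    unfolding N_def
    by (rule computable_Least[OF _ ex], unfold close_def)
      (intro computable_intros computable_comp[OF P(1)] computable_comp[OF comp(1)]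
        computable_comp[OF comp(2)] computable_comp[OF comp(3)])
  moreover have "measure \<mu> (hits P - stage P (N k)) \<le> 1 / 2 ^ k" for k
  proof -
    have "close (N k) k" unfolding N_def by (rule LeastI_ex[OF ex])
    then have "r (k + 2) \<le> measure \<mu> (stage P (N k)) + 1 / 2 ^ (k + 1)"
      by (simp only: close_iff)
    moreover have "measure \<mu> (hits P - stage P (N k)) = measure \<mu> X - measure \<mu> (stage P (N k))"
      unfolding P(3) by (intro cantor.finite_measure_Diff hits_measurable stage_measurable stage_subset_hits)
    moreover have "1 / 2 ^ (k + 1) + 1 / 2 ^ (k + 2) \<le> 1 / (2::real) ^ k"
      by (simp add: divide_simps)
    ultimately show ?thesis using r[of "k + 2"] by linarith
  qed
  ultimately show ?thesis using that P by blast
qed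

lemma excess_antimono:
  assumes "extension_closed P" "m \<le> n"
  shows "measure \<mu> (hits P - stage P n) \<le> measure \<mu> (hits P - stage P m)"
  using stage_mono[OF assms] by (intro cantor.finite_measure_mono) auto

lemma schnorr_open_Un:
  assumes "schnorr_open X" "schnorr_open Y"
  shows "schnorr_open (X \<union> Y)"
proof -
  obtain P N where P: "computable P" "extension_closed P" "X = hits P" "computable N"
    "\<And>k. measure \<mu> (hits P - stage P (N k)) \<le> 1 / 2 ^ k"
    using schnorr_openE[OF assms(1)] by blast
  obtain Q M where Q: "computable Q" "extension_closed Q" "Y = hits Q" "computable M"
    "\<And>k. measure \<mu> (hits Q - stage Q (M k)) \<le> 1 / 2 ^ k"
    using schnorr_openE[OF assms(2)] by blast
  let ?R = "\<lambda>\<sigma>. P \<sigma> \<or> Q \<sigma>"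
  \<comment> \<open>a computable upper bound of both moduli; half of the error is left to each set\<close>
  let ?n = "\<lambda>k. N (Suc k) + M (Suc k)"
  have "schnorr_open (hits ?R)"
  proof (rule schnorr_openI)
    show "computable ?R" by (intro computable_intros P Q)
    show "computable ?n"
      by (intro computable_intros computable_comp[OF P(4)] computable_comp[OF Q(4)])
    fix k
    have "hits ?R - stage ?R (?n k) \<subseteq> (hits P - stage P (?n k)) \<union> (hits Q - stage Q (?n k))"
      by (auto simp: hits_def stage_def)
    then have "measure \<mu> (hits ?R - stage ?R (?n k))
        \<le> measure \<mu> ((hits P - stage P (?n k)) \<union> (hits Q - stage Q (?n k)))"
      by (intro cantor.finite_measure_mono) auto
    also have "\<dots> \<le> measure \<mu> (hits P - stage P (?n k)) + measure \<mu> (hits Q - stage Q (?n k))"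
      by (intro measure_Un_le) auto
    also have "\<dots> \<le> 1 / 2 ^ Suc k + 1 / 2 ^ Suc k"
      using excess_antimono[OF P(2), of "N (Suc k)" "?n k"] P(5)[of "Suc k"]
        excess_antimono[OF Q(2), of "M (Suc k)" "?n k"] Q(5)[of "Suc k"] by simp
    finally show "measure \<mu> (hits ?R - stage ?R (?n k)) \<le> 1 / 2 ^ k" by simp
  qed
  then show ?thesis by (simp add: P(3) Q(3) hits_Un)
qed

lemma excess_above_le:
  assumes "extension_closed P"
  shows "measure \<mu> (above (hits P) \<sigma> - stage (\<lambda>\<tau>. P (\<sigma> @ \<tau>)) n)
    \<le> 2 ^ length \<sigma> * measure \<mu> (hits P - stage P n)"
proof -
  have "above (hits P) \<sigma> - stage (\<lambda>\<tau>. P (\<sigma> @ \<tau>)) n = above (hits P - stage P (length \<sigma> + n)) \<sigma>"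
    unfolding above_stage[symmetric] by (auto simp: above_def)
  then have "measure \<mu> (above (hits P) \<sigma> - stage (\<lambda>\<tau>. P (\<sigma> @ \<tau>)) n)
      \<le> 2 ^ length \<sigma> * measure \<mu> (hits P - stage P (length \<sigma> + n))"
    using measure_above_le[of "hits P - stage P (length \<sigma> + n)" \<sigma>] by auto
  also have "\<dots> \<le> 2 ^ length \<sigma> * measure \<mu> (hits P - stage P n)"
    by (intro mult_left_mono excess_antimono[OF assms]) auto
  finally show ?thesis .
qed

text \<open>
  Above \<open>\<sigma>\<close> errors grow by the factor \<open>2 ^ length \<sigma>\<close>, so the modulus of \<open>X\<close> has to be read that many
  bits further.
\<close>

lemma schnorr_open_above:
  assumes "schnorr_open X"
  shows "schnorr_open (above X \<sigma>)"
proof -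
  obtain P N where P: "computable P" "extension_closed P" "X = hits P" "computable N"
    and N: "\<And>k. measure \<mu> (hits P - stage P (N k)) \<le> 1 / 2 ^ k"
    using schnorr_openE[OF assms] by blast
  let ?N = "\<lambda>k. N (k + length \<sigma>)"
  have above: "above X \<sigma> = hits (\<lambda>\<tau>. P (\<sigma> @ \<tau>))"
    unfolding P(3) by (rule above_hits_extension_closed[OF P(2)])
  have "schnorr_open (hits (\<lambda>\<tau>. P (\<sigma> @ \<tau>)))"
  proof (rule schnorr_openI)
    show "computable (\<lambda>\<tau>. P (\<sigma> @ \<tau>))"
      by (intro computable_comp[OF P(1)] computable_intros)
    show "computable ?N"
      by (intro computable_comp[OF P(4)] computable_intros)
    fix k
    have "measure \<mu> (hits (\<lambda>\<tau>. P (\<sigma> @ \<tau>)) - stage (\<lambda>\<tau>. P (\<sigma> @ \<tau>)) (?N k))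
        \<le> 2 ^ length \<sigma> * measure \<mu> (hits P - stage P (?N k))"
      using excess_above_le[OF P(2), of \<sigma> "?N k"] above P(3) by simp
    also have "\<dots> \<le> 2 ^ length \<sigma> * (1 / 2 ^ (k + length \<sigma>))"
      by (intro mult_left_mono N) auto
    also have "\<dots> = 1 / 2 ^ k" by (simp add: power_add)
    finally show "measure \<mu> (hits (\<lambda>\<tau>. P (\<sigma> @ \<tau>)) - stage (\<lambda>\<tau>. P (\<sigma> @ \<tau>)) (?N k)) \<le> 1 / 2 ^ k" .
  qed
  then show ?thesis by (simp add: above)
qed

text \<open>
  If \<open>X\<close> fills each of finitely many disjoint cylinders up to a proportion \<open>\<delta>\<close>, it misses at most the
  proportion \<open>\<delta>\<close> of their union.
\<close>

lemma measure_stage_Diff_le: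
  assumes "X \<in> sets \<mu>" and "\<And>\<sigma>. length \<sigma> = n \<Longrightarrow> R \<sigma> \<Longrightarrow> 1 - \<delta> \<le> measure \<mu> (above X \<sigma>)" "\<delta> \<ge> 0"
  shows "measure \<mu> (stage R n - X) \<le> \<delta>"
proof -
  let ?S = "{\<sigma>. length \<sigma> = n \<and> R \<sigma>}"
  have single: "measure \<mu> ((UNIV - X) \<inter> cylinder \<sigma>) \<le> \<delta> / 2 ^ n" if "\<sigma> \<in> ?S" for \<sigma>
  proof -
    have "UNIV - X \<in> sets \<mu>" using sets.compl_sets[OF assms(1)] by simp
    then have "measure \<mu> ((UNIV - X) \<inter> cylinder \<sigma>) = measure \<mu> (above (UNIV - X) \<sigma>) / 2 ^ n"
      using measure_Int_cylinder[of "UNIV - X" \<sigma>] that by simp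
    moreover have "above (UNIV - X) \<sigma> = UNIV - above X \<sigma>"
      by (auto simp: above_def)
    moreover have "measure \<mu> (UNIV - above X \<sigma>) = 1 - measure \<mu> (above X \<sigma>)"
      using cantor.prob_compl[OF above_measurable[OF assms(1)]] by simp
    ultimately show ?thesis
      using assms(2)[of \<sigma>] that by (simp add: divide_right_mono)
  qed
  have "stage R n - X = (\<Union>\<sigma>\<in>?S. (UNIV - X) \<inter> cylinder \<sigma>)"
    unfolding stage_eq by auto
  then have "measure \<mu> (stage R n - X) \<le> (\<Sum>\<sigma>\<in>?S. measure \<mu> ((UNIV - X) \<inter> cylinder \<sigma>))"
    using sets.compl_sets[OF assms(1)]
    by (simp only:) (intro measure_UNION_le finite_strings sets.Int cylinder_measurable, simp)
  also have "\<dots> \<le> (\<Sum>\<sigma>\<in>?S. \<delta> / 2 ^ n)"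
    by (intro sum_mono single)
  also have "\<dots> = measure \<mu> (stage R n) * \<delta>"
    by (simp add: measure_stage)
  also have "\<dots> \<le> \<delta>"
    using mult_right_mono[OF cantor.prob_le_1[of "stage R n"] assms(3)] by simp
  finally show ?thesis .
qed

text \<open>
  A threshold \<open>q\<close> that is the same for all strings leaves no computable control over the measure of
  the set it defines. Here the threshold \<open>1 - 1 / 2 ^ (length \<sigma> + c)\<close> tends to \<open>1\<close>, and it is compared with a stage
  of \<open>X\<close> above \<open>\<sigma>\<close> that is accurate to the same error. The test \<open>R\<close> is then decidable, is passed by all
  \<open>\<sigma>\<close> with \<open>\<mu> (above X \<sigma>) = 1\<close>, and every string that passes it has a cylinder almost filled by \<open>X\<close>.
  What \<open>V\<close> adds to \<open>X\<close> through strings of length at least \<open>n\<close> has measure at most \<open>2 / 2 ^ (n + c)\<close>.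
\<close>

lemma schnorr_superset_of_density_points:
  assumes "schnorr_open X" "measure \<mu> X < 1"
  shows "\<exists>V. schnorr_open V \<and> measure \<mu> V < 1 \<and>
    (\<forall>\<sigma>. measure \<mu> (above X \<sigma>) = 1 \<longrightarrow> cylinder \<sigma> \<subseteq> V)"
proof -
  obtain P N where P: "computable P" "extension_closed P" "computable N" and X: "X = hits P"
    and N: "\<And>k. measure \<mu> (hits P - stage P (N k)) \<le> 1 / 2 ^ k"
    using schnorr_openE[OF assms(1)] by blast
  have X_sets: "X \<in> sets \<mu>" by (simp add: X)
  obtain c where c: "2 / 2 ^ c < 1 - measure \<mu> X"
    using real_arch_pow_inv[of "(1 - measure \<mu> X) / 2" "1 / 2"] assms(2)
    by (auto simp: power_divide field_simps)
  \<comment> \<open>one \<open>length \<sigma>\<close> compensates the factor lost above \<open>\<sigma>\<close>, the other makes the error decrease\<close>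
  define l where "l \<sigma> = N (2 * length \<sigma> + c)" for \<sigma> :: "bool list"
  define R where "R \<sigma> \<longleftrightarrow> 2 ^ l \<sigma> * 2 ^ (length \<sigma> + c)
      \<le> card {\<tau>. length \<tau> = l \<sigma> \<and> P (\<sigma> @ \<tau>)} * 2 ^ (length \<sigma> + c) + 2 ^ l \<sigma>" for \<sigma>
  have "computable l"
    unfolding l_def by (intro computable_intros computable_comp[OF P(3)])
  then have "computable R"
    unfolding R_def by (intro computable_intros computable_comp[OF P(1)] computable_comp[OF \<open>computable l\<close>])
  have R_iff: "R \<sigma> \<longleftrightarrow> 1 - 1 / 2 ^ (length \<sigma> + c) \<le> measure \<mu> (stage (\<lambda>\<tau>. P (\<sigma> @ \<tau>)) (l \<sigma>))" for \<sigma>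
  proof -
    have arith: "1 - 1 / t \<le> m / s \<longleftrightarrow> s * t \<le> m * t + s"
      if "s > 0" "t > 0" for m s t :: real
      using that by (simp add: divide_simps) (simp add: algebra_simps)
    have "R \<sigma> \<longleftrightarrow> real (2 ^ l \<sigma> * 2 ^ (length \<sigma> + c))
      \<le> real (card {\<tau>. length \<tau> = l \<sigma> \<and> P (\<sigma> @ \<tau>)} * 2 ^ (length \<sigma> + c) + 2 ^ l \<sigma>)"
      unfolding R_def of_nat_le_iff ..
    also have "\<dots> \<longleftrightarrow> 1 - 1 / 2 ^ (length \<sigma> + c) \<le> measure \<mu> (stage (\<lambda>\<tau>. P (\<sigma> @ \<tau>)) (l \<sigma>))"
      unfolding measure_stage by (subst arith) auto
    finally show ?thesis .
  qed
  have stage_le: "measure \<mu> (stage (\<lambda>\<tau>. P (\<sigma> @ \<tau>)) n) \<le> measure \<mu> (above X \<sigma>)" for \<sigma> n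
    unfolding X above_hits_extension_closed[OF P(2)]
    by (intro cantor.finite_measure_mono stage_subset_hits hits_measurable)
  have R_large: "1 - 1 / 2 ^ (length \<sigma> + c) \<le> measure \<mu> (above X \<sigma>)" if "R \<sigma>" for \<sigma>
    using that stage_le[of \<sigma> "l \<sigma>"] unfolding R_iff by linarith
  have R_full: "R \<sigma>" if "measure \<mu> (above X \<sigma>) = 1" for \<sigma>
  proof -
    have "measure \<mu> (above X \<sigma> - stage (\<lambda>\<tau>. P (\<sigma> @ \<tau>)) (l \<sigma>))
        = measure \<mu> (above X \<sigma>) - measure \<mu> (stage (\<lambda>\<tau>. P (\<sigma> @ \<tau>)) (l \<sigma>))"
      unfolding X above_hits_extension_closed[OF P(2)]
      by (intro cantor.finite_measure_Diff hits_measurable stage_measurable stage_subset_hits)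
    moreover have "measure \<mu> (above X \<sigma> - stage (\<lambda>\<tau>. P (\<sigma> @ \<tau>)) (l \<sigma>))
        \<le> 2 ^ length \<sigma> * (1 / 2 ^ (2 * length \<sigma> + c))"
      using excess_above_le[OF P(2), of \<sigma> "l \<sigma>"] N[of "2 * length \<sigma> + c"] unfolding X l_def
      by (meson mult_left_mono order_trans zero_le_numeral zero_le_power)
    moreover have "2 ^ length \<sigma> * (1 / 2 ^ (2 * length \<sigma> + c)) = 1 / (2::real) ^ (length \<sigma> + c)"
      by (simp add: power_add mult_2)
    ultimately show ?thesis unfolding R_iff using that by linarith
  qed
  have P_R: "R \<sigma>" if "P \<sigma>" for \<sigma>
    using above_hits_eq_UNIV[of \<sigma> \<sigma> P] that by (intro R_full) (simp add: X)
  \<comment> \<open>what the strings of length \<open>n\<close> add to \<open>X\<close>\<close>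
  define L where "L n = stage R n - X" for n
  have L_sets: "L n \<in> sets \<mu>" for n by (simp add: L_def X)
  have L_le: "measure \<mu> (L n) \<le> 1 / 2 ^ (n + c)" for n
    unfolding L_def using R_large by (intro measure_stage_Diff_le X_sets) auto
  have tail: "measure \<mu> (\<Union>i. L (n + i)) \<le> 2 / 2 ^ (n + c)" for n
  proof -
    have sums: "(\<lambda>i. 1 / 2 ^ (n + c) * (1 / 2) ^ i :: real) sums (1 / 2 ^ (n + c) * 2)"
      using sums_mult[OF geometric_sums[of "1/2 :: real"], of "1 / 2 ^ (n + c)"] by simp
    have le: "measure \<mu> (L (n + i)) \<le> 1 / 2 ^ (n + c) * (1 / 2) ^ i" for i
      using L_le[of "n + i"] by (simp add: power_add power_divide mult_ac)
    then have summable: "summable (\<lambda>i. measure \<mu> (L (n + i)))"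
      by (intro summable_comparison_test'[OF sums_summable[OF sums]]) simp
    have "measure \<mu> (\<Union>i. L (n + i)) \<le> (\<Sum>i. measure \<mu> (L (n + i)))"
      using L_sets summable by (intro cantor.finite_measure_subadditive_countably) auto
    also have "\<dots> \<le> (\<Sum>i. 1 / 2 ^ (n + c) * (1 / 2) ^ i)"
      by (intro suminf_le le summable sums_summable[OF sums])
    finally show ?thesis using sums_unique[OF sums] by simp
  qed
  define Q where "Q \<tau> \<longleftrightarrow> (\<exists>k<Suc (length \<tau>). R (take k \<tau>))" for \<tau>
  have Q_initial: "Q (initial Z n) \<longleftrightarrow> (\<exists>k\<le>n. R (initial Z k))" for Z n
    by (auto simp: Q_def less_Suc_eq_le min_def)
  have hits_Q: "Z \<in> hits Q \<longleftrightarrow> (\<exists>k. R (initial Z k))" for Z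
    unfolding hits_def by (auto simp: Q_initial)
  have "schnorr_open (hits Q)"
  proof (rule schnorr_openI)
    show "computable Q"
      unfolding Q_def by (intro computable_intros computable_comp[OF \<open>computable R\<close>])
    show "computable (\<lambda>k. N (k + 1) + (k + 1))"
      by (intro computable_intros computable_comp[OF P(3)])
    fix k
    let ?n = "N (k + 1) + (k + 1)"
    \<comment> \<open>\<open>stage P\<close> is contained in \<open>stage Q\<close>, so whatever of \<open>X\<close> is still missing is missing from \<open>stage P\<close> too\<close>
    have "hits Q - stage Q ?n \<subseteq> (hits P - stage P ?n) \<union> (\<Union>i. L (Suc ?n + i))"
    proof
      fix Z assume Z: "Z \<in> hits Q - stage Q ?n"
      then obtain m where m: "R (initial Z m)" by (auto simp: hits_Q)
      have no: "\<not> R (initial Z j)" if "j \<le> ?n" for j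
        using Z that by (auto simp: stage_def Q_initial)
      then have "m \<ge> Suc ?n" using m by (meson not_less_eq_eq)
      then obtain i where i: "m = Suc ?n + i" using le_Suc_ex by blast
      have "Z \<in> X \<or> Z \<in> L m" using m by (auto simp: L_def stage_def)
      then have "Z \<in> X \<or> Z \<in> L (Suc ?n + i)" unfolding i .
      moreover have "Z \<notin> stage P ?n"
        using no P_R by (auto simp: stage_def)
      ultimately show "Z \<in> (hits P - stage P ?n) \<union> (\<Union>i. L (Suc ?n + i))"
        unfolding X by blast
    qed
    then have "measure \<mu> (hits Q - stage Q ?n) \<le> measure \<mu> ((hits P - stage P ?n) \<union> (\<Union>i. L (Suc ?n + i)))"
      using L_sets by (intro cantor.finite_measure_mono sets.Un sets.Diff sets.countable_UN) auto
    also have "\<dots> \<le> measure \<mu> (hits P - stage P ?n) + measure \<mu> (\<Union>i. L (Suc ?n + i))"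
      using L_sets by (intro measure_Un_le sets.Diff sets.countable_UN) auto
    also have "\<dots> \<le> 1 / 2 ^ (k + 1) + 1 / 2 ^ (k + 1)"
    proof (rule add_mono)
      show "measure \<mu> (hits P - stage P ?n) \<le> 1 / 2 ^ (k + 1)"
        using excess_antimono[OF P(2), of "N (k + 1)" ?n] N[of "k + 1"] by simp
      have "2 / 2 ^ (Suc ?n + c) \<le> 2 / (2::real) ^ (k + 2)"
        by (intro divide_left_mono power_increasing) auto
      then show "measure \<mu> (\<Union>i. L (Suc ?n + i)) \<le> 1 / 2 ^ (k + 1)"
        using tail[of "Suc ?n"] by simp
    qed
    finally show "measure \<mu> (hits Q - stage Q ?n) \<le> 1 / 2 ^ k" by simp
  qed
  moreover have "measure \<mu> (hits Q) < 1"
  proof -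
    have "hits Q \<subseteq> X \<union> (\<Union>i. L (0 + i))"
      by (auto simp: hits_Q L_def stage_def)
    then have "measure \<mu> (hits Q) \<le> measure \<mu> (X \<union> (\<Union>i. L (0 + i)))"
      using L_sets X_sets by (intro cantor.finite_measure_mono sets.Un sets.countable_UN) auto
    also have "\<dots> \<le> measure \<mu> X + measure \<mu> (\<Union>i. L (0 + i))"
      using L_sets X_sets by (intro measure_Un_le sets.countable_UN) auto
    also have "\<dots> < 1" using tail[of 0] c by simp
    finally show ?thesis .
  qed
  moreover have "cylinder \<sigma> \<subseteq> hits Q" if "measure \<mu> (above X \<sigma>) = 1" for \<sigma>
    using R_full[OF that] by (auto simp: hits_Q cylinder_iff_initial intro!: exI[of _ "length \<sigma>"])
  ultimately show ?thesis by blast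
qed


section \<open>Winning sets\<close>

lemma exactly_computableI:
  assumes "computable a" "computable b" "\<And>\<sigma>. b \<sigma> > 0" "\<And>\<sigma>. d \<sigma> = real (a \<sigma>) / real (b \<sigma>)"
  shows "exactly_computable d"
proof -
  have "computable (\<lambda>c. a (string_of c))" "computable (\<lambda>c. b (string_of c) - 1)"
    by (intro computable_intros computable_comp[OF assms(1)] computable_comp[OF assms(2)])+
  then obtain A B where "recursive 1 A" "recursive 1 B"
    and eq: "\<And>c. A [c] = a (string_of c)" "\<And>c. B [c] = b (string_of c) - 1"
    unfolding computable_nat1_iff by blast
  moreover have "d \<sigma> = real (A [str_code \<sigma>]) / real (Suc (B [str_code \<sigma>]))" for \<sigma>
    using assms(3)[of \<sigma>] by (simp add: eq assms(4))
  ultimately show ?thesis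
    unfolding exactly_computable_def by blast
qed

lemma exactly_computableE:
  assumes "exactly_computable d"
  obtains a b where "computable a" "computable b" "\<And>\<sigma>. b \<sigma> > 0" "\<And>\<sigma>. d \<sigma> = real (a \<sigma>) / real (b \<sigma>)"
proof -
  obtain A B where "recursive 1 A" "recursive 1 B"
    and d: "\<And>\<sigma>. d \<sigma> = real (A [str_code \<sigma>]) / real (Suc (B [str_code \<sigma>]))"
    using assms unfolding exactly_computable_def by blast
  then have "computable (\<lambda>c. A [c])" "computable (\<lambda>c. B [c])"
    unfolding computable_nat1_iff by blast+
  then have "computable (\<lambda>\<sigma>. A [str_code \<sigma>])" "computable (\<lambda>\<sigma>. Suc (B [str_code \<sigma>]))"
    by (auto intro!: computable_intros computable_comp[where g = str_code])
  then show ?thesis using that d by blast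
qed

lemma winning_open_iff:
  "winning_open X \<longleftrightarrow> (\<exists>d q. ecn_martingale d \<and> q \<in> \<rat> \<and> q > 1 \<and> X = hits (\<lambda>\<sigma>. d \<sigma> \<ge> q))"
  unfolding winning_open_def winning_strings_def winning_set_of_def
    generated_minimal_strings[symmetric]
  by blast

lemma induced_test_eq_hits: "induced_test d n = hits (\<lambda>\<sigma>. d \<sigma> \<ge> 2 ^ n)"
  by (simp add: induced_test_def winning_set_of_def generated_minimal_strings)

lemma winning_open_bounded:
  assumes "winning_open X"
  shows "bounded_open X"
proof -
  obtain d q where d: "ecn_martingale d" "q > 1" and X: "X = hits (\<lambda>\<sigma>. d \<sigma> \<ge> q)"
    using assms unfolding winning_open_iff by blast
  then have "measure \<mu> X \<le> 1 / q"
    using Ville[of q d] by (simp add: ecn_martingale_def normed_def)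
  also have "1 / q < 1" using d(2) by simp
  finally show ?thesis by (simp add: bounded_open_def X open_hits)
qed

lemma test_induced_test:
  assumes "ecn_martingale d"
  shows "test (induced_test d)"
  unfolding test_def
proof (intro conjI allI)
  have "(2::real) ^ m \<le> 2 ^ n" if "m \<le> n" for m n
    using that by (rule power_increasing) simp
  then show "decseq (induced_test d)"
    unfolding decseq_def induced_test_eq_hits hits_def by (blast intro: order_trans)
  show "open (induced_test d n)" for n
    by (simp add: induced_test_eq_hits open_hits)
  show "measure \<mu> (\<Inter>n. induced_test d n) = 0"
  proof (rule measure_INT_eq_0)
    show "induced_test d n \<in> sets \<mu>" for n by (simp add: induced_test_eq_hits)
    show "measure \<mu> (induced_test d n) \<le> 1 / 2 ^ n" for n
      using Ville[of "2 ^ n" d] assms by (simp add: induced_test_eq_hits ecn_martingale_def normed_def)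
  qed
qed

lemma ecn_martingale_const: "ecn_martingale (\<lambda>\<sigma>. 1)"
  using exactly_computableI[of "\<lambda>\<sigma>. 1" "\<lambda>\<sigma>. 1" "\<lambda>\<sigma>. 1"]
  by (simp add: ecn_martingale_def martingale_def normed_def computable_const)

lemma ecn_martingale_above:
  assumes "ecn_martingale d" "d \<sigma> > 0"
  shows "ecn_martingale (\<lambda>\<tau>. d (\<sigma> @ \<tau>) / d \<sigma>)"
proof -
  obtain a b where ab: "computable a" "computable b"
    and b: "\<And>\<rho>. b \<rho> > 0" and d: "\<And>\<rho>. d \<rho> = real (a \<rho>) / real (b \<rho>)"
    using assms(1) exactly_computableE unfolding ecn_martingale_def by blast
  have "a \<sigma> > 0" using assms(2) d[of \<sigma>] by (cases "a \<sigma>") auto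
  have "exactly_computable (\<lambda>\<tau>. d (\<sigma> @ \<tau>) / d \<sigma>)"
  proof (rule exactly_computableI)
    show "computable (\<lambda>\<tau>. a (\<sigma> @ \<tau>) * b \<sigma>)"
      by (intro computable_intros computable_comp[OF ab(1)])
    show "computable (\<lambda>\<tau>. b (\<sigma> @ \<tau>) * a \<sigma>)"
      by (intro computable_intros computable_comp[OF ab(2)])
  qed (use b \<open>a \<sigma> > 0\<close> in \<open>auto simp: d\<close>)
  moreover have "martingale (\<lambda>\<tau>. d (\<sigma> @ \<tau>) / d \<sigma>)"
  proof -
    have mart: "martingale (\<lambda>\<tau>. d (\<sigma> @ \<tau>))"
      using assms(1) by (intro martingale_above) (simp add: ecn_martingale_def)
    show ?thesis
      unfolding martingale_def
    proof (intro conjI allI)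
      fix \<tau>
      show "0 \<le> d (\<sigma> @ \<tau>) / d \<sigma>"
        using mart assms(2) unfolding martingale_def by simp
      have "d (\<sigma> @ \<tau>) = (d (\<sigma> @ \<tau> @ [False]) + d (\<sigma> @ \<tau> @ [True])) / 2"
        using mart unfolding martingale_def by blast
      then have "d (\<sigma> @ \<tau>) / d \<sigma> = ((d (\<sigma> @ \<tau> @ [False]) + d (\<sigma> @ \<tau> @ [True])) / 2) / d \<sigma>"
        by (rule arg_cong)
      then show "d (\<sigma> @ \<tau>) / d \<sigma> = (d (\<sigma> @ \<tau> @ [False]) / d \<sigma> + d (\<sigma> @ \<tau> @ [True]) / d \<sigma>) / 2"
        by (simp only: add_divide_distrib divide_divide_eq_left mult.commute)
    qed
  qed
  ultimately show ?thesis
    using assms(2) by (simp add: ecn_martingale_def normed_def)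
qed

text \<open>
  No prefix of \<open>\<sigma>\<close> has reached the target, so the set above \<open>\<sigma>\<close> is the one won by \<open>d\<close> started at \<open>\<sigma>\<close>,
  normalized together with its target by \<open>d \<sigma>\<close>. If \<open>d \<sigma> = 0\<close>, nothing is won above \<open>\<sigma>\<close> and any set of
  the class will do.
\<close>

lemma winning_open_above:
  assumes "winning_open X" "measure \<mu> (above X \<sigma>) < 1"
  shows "\<exists>V. winning_open V \<and> above X \<sigma> \<subseteq> V"
proof -
  obtain d q where d: "ecn_martingale d" "q \<in> \<rat>" "q > 1" and X: "X = hits (\<lambda>\<sigma>. d \<sigma> \<ge> q)"
    using assms(1) unfolding winning_open_iff by blast
  have less: "d \<rho> < q" if "prefix \<rho> \<sigma>" for \<rho>
    using above_hits_eq_UNIV[OF that, of "\<lambda>\<sigma>. d \<sigma> \<ge> q"] assms(2) X by (cases "d \<rho> < q") auto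
  have above: "above X \<sigma> = hits (\<lambda>\<tau>. d (\<sigma> @ \<tau>) \<ge> q)"
    unfolding X using less by (intro above_hits) (auto simp: strict_prefix_def not_le[symmetric])
  have mart: "martingale (\<lambda>\<tau>. d (\<sigma> @ \<tau>))"
    using d(1) by (intro martingale_above) (simp add: ecn_martingale_def)
  show ?thesis
  proof (cases "d \<sigma> = 0")
    case True
    have "d (\<sigma> @ \<tau>) = 0" for \<tau>
    proof (induction \<tau> rule: rev_induct)
      case (snoc b \<tau>)
      have "d (\<sigma> @ \<tau>) = (d (\<sigma> @ \<tau> @ [False]) + d (\<sigma> @ \<tau> @ [True])) / 2"
        "d (\<sigma> @ \<tau> @ [False]) \<ge> 0" "d (\<sigma> @ \<tau> @ [True]) \<ge> 0"
        using mart unfolding martingale_def by blast+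
      then show ?case using snoc by (cases b) auto
    qed (simp add: True)
    then have "above X \<sigma> = {}" using d(3) by (simp add: above hits_def)
    then show ?thesis using assms(1) by blast
  next
    case False
    have "d \<sigma> \<ge> 0" using d(1) by (simp add: ecn_martingale_def martingale_def)
    with False have pos: "d \<sigma> > 0" by simp
    obtain a b where "d \<sigma> = real (a \<sigma>) / real (b \<sigma>)"
      using d(1) exactly_computableE unfolding ecn_martingale_def by metis
    then have "q / d \<sigma> \<in> \<rat>" using d(2) by simp
    moreover have "q / d \<sigma> > 1" using less[OF prefix_order.refl] pos by simp
    moreover have "above X \<sigma> = hits (\<lambda>\<tau>. d (\<sigma> @ \<tau>) / d \<sigma> \<ge> q / d \<sigma>)"
      unfolding above using pos by (simp add: divide_le_cancel)
    ultimately have "winning_open (above X \<sigma>)"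
      unfolding winning_open_iff using ecn_martingale_above[OF d(1) pos] by blast
    then show ?thesis by blast
  qed
qed

text \<open>
  If \<open>d\<close> stays below \<open>q\<close> on all prefixes of \<open>\<sigma>\<close>, then \<open>\<mu> (above X \<sigma>) \<le> d \<sigma> / q < 1\<close> by Ville's inequality.
\<close>

lemma winning_open_contains_full_cylinders:
  assumes "winning_open X" "measure \<mu> (above X \<sigma>) = 1"
  shows "cylinder \<sigma> \<subseteq> X"
proof
  fix Z assume Z: "Z \<in> cylinder \<sigma>"
  obtain d q where d: "ecn_martingale d" "q > 1" and X: "X = hits (\<lambda>\<sigma>. d \<sigma> \<ge> q)"
    using assms(1) unfolding winning_open_iff by blast
  show "Z \<in> X"
  proof (rule ccontr)
    assume "Z \<notin> X"
    then have less: "d (initial Z k) < q" for k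
      by (auto simp: X hits_def not_le)
    have "\<sigma> = initial Z (length \<sigma>)" using Z by (simp add: cylinder_iff_initial)
    then have "d \<sigma> < q" "\<And>\<rho>. strict_prefix \<rho> \<sigma> \<Longrightarrow> d \<rho> < q"
      using less strict_prefix_initial_iff[of _ Z "length \<sigma>"] by metis+
    then have "measure \<mu> (above X \<sigma>) \<le> d \<sigma> / q"
      unfolding X using d by (intro Ville_above) (auto simp: ecn_martingale_def)
    also have "d \<sigma> / q < 1" using \<open>d \<sigma> < q\<close> d(2) by simp
    finally show False using assms(2) by simp
  qed
qed

lemma ecn_martingale_convex_combination:
  fixes K :: nat
  assumes "ecn_martingale d" "ecn_martingale e" "K > 0"
  shows "ecn_martingale (\<lambda>\<sigma>. (1 - 1 / K) * d \<sigma> + 1 / K * e \<sigma>)"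
proof -
  obtain a b where ab: "computable a" "computable b"
    and b: "\<And>\<rho>. b \<rho> > 0" and d: "\<And>\<rho>. d \<rho> = real (a \<rho>) / real (b \<rho>)"
    using assms(1) exactly_computableE unfolding ecn_martingale_def by blast
  obtain a' b' where ab': "computable a'" "computable b'"
    and b': "\<And>\<rho>. b' \<rho> > 0" and e: "\<And>\<rho>. e \<rho> = real (a' \<rho>) / real (b' \<rho>)"
    using assms(2) exactly_computableE unfolding ecn_martingale_def by blast
  let ?f = "\<lambda>\<sigma>. (1 - 1 / real K) * d \<sigma> + 1 / real K * e \<sigma>"
  have "exactly_computable ?f"
  proof (rule exactly_computableI)
    show "computable (\<lambda>\<sigma>. (K - 1) * a \<sigma> * b' \<sigma> + a' \<sigma> * b \<sigma>)"
      by (intro computable_intros ab ab')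
    show "computable (\<lambda>\<sigma>. K * b \<sigma> * b' \<sigma>)"
      by (intro computable_intros ab ab')
    show "K * b \<sigma> * b' \<sigma> > 0" for \<sigma> using assms(3) b b' by simp
    show "?f \<sigma> = real ((K - 1) * a \<sigma> * b' \<sigma> + a' \<sigma> * b \<sigma>) / real (K * b \<sigma> * b' \<sigma>)" for \<sigma>
      using assms(3) b[of \<sigma>] b'[of \<sigma>] by (simp add: d e of_nat_diff field_simps)
  qed
  moreover have "martingale ?f"
  proof -
    have arith: "(1 - k) * ((x + y) / 2) + k * ((u + v) / 2)
        = (((1 - k) * x + k * u) + ((1 - k) * y + k * v)) / 2" for k x y u v :: real
      by (simp add: field_simps)
    have "0 \<le> (1 - 1 / real K)" using assms(3) by simp
    then have "0 \<le> ?f \<sigma>" for \<sigma>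
      using assms unfolding ecn_martingale_def martingale_def by (intro add_nonneg_nonneg mult_nonneg_nonneg) auto
    moreover have "?f \<sigma> = (?f (\<sigma> @ [False]) + ?f (\<sigma> @ [True])) / 2" for \<sigma>
    proof -
      have "d \<sigma> = (d (\<sigma> @ [False]) + d (\<sigma> @ [True])) / 2" "e \<sigma> = (e (\<sigma> @ [False]) + e (\<sigma> @ [True])) / 2"
        using assms unfolding ecn_martingale_def martingale_def by blast+
      then have "?f \<sigma> = (1 - 1 / real K) * ((d (\<sigma> @ [False]) + d (\<sigma> @ [True])) / 2)
          + 1 / real K * ((e (\<sigma> @ [False]) + e (\<sigma> @ [True])) / 2)"
        by (simp only:)
      also have "\<dots> = (?f (\<sigma> @ [False]) + ?f (\<sigma> @ [True])) / 2"
        by (rule arith)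
      finally show ?thesis .
    qed
    ultimately show ?thesis unfolding martingale_def by blast
  qed
  ultimately show ?thesis
    using assms by (simp add: ecn_martingale_def normed_def)
qed

text \<open>
  Putting the capital \<open>1 / K\<close> on \<open>e\<close> and the rest on \<open>d\<close>, with the target lowered in proportion to
  \<open>r K = (1 - 1 / K) * q\<close>, keeps all wins of \<open>d\<close> and adds those of \<open>e\<close> from \<open>2 ^ n \<ge> r K * K\<close> on. As \<open>K\<close> grows, the
  mixture and its target converge to \<open>d\<close> and \<open>q\<close>, so the finitely many strict inequalities \<open>d \<rho> < q\<close>
  along \<open>\<sigma>\<close> carry over, and Ville's inequality applies above \<open>\<sigma>\<close>.
\<close>

lemma winning_open_Un_induced_test:
  assumes X: "winning_open X" "measure \<mu> (above X \<sigma>) < 1" and e: "ecn_martingale e"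
  shows "\<exists>n V. winning_open V \<and> X \<union> induced_test e n \<subseteq> V \<and> measure \<mu> (above V \<sigma>) < 1"
proof -
  obtain d q where d: "ecn_martingale d" "q \<in> \<rat>" "q > 1" and X_eq: "X = hits (\<lambda>\<sigma>. d \<sigma> \<ge> q)"
    using X(1) unfolding winning_open_iff by blast
  have less: "d \<rho> < q" if "prefix \<rho> \<sigma>" for \<rho>
    using above_hits_eq_UNIV[OF that, of "\<lambda>\<sigma>. d \<sigma> \<ge> q"] X(2) X_eq by (cases "d \<rho> < q") auto
  define f where "f K \<rho> = (1 - 1 / real K) * d \<rho> + 1 / real K * e \<rho>" for K \<rho>
  define r where "r K = (1 - 1 / real K) * q" for K
  have inv: "(\<lambda>K. 1 / real K) \<longlonglongrightarrow> 0"
    by (rule lim_1_over_n)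
  have r_lim: "r \<longlonglongrightarrow> q"
    unfolding r_def using tendsto_mult[OF tendsto_diff[OF tendsto_const[of 1] inv] tendsto_const[of q]] by simp
  have "(\<lambda>K. f K \<rho>) \<longlonglongrightarrow> d \<rho>" for \<rho>
    unfolding f_def
    using tendsto_add[OF tendsto_mult[OF tendsto_diff[OF tendsto_const[of 1] inv] tendsto_const[of "d \<rho>"]]
        tendsto_mult[OF inv tendsto_const[of "e \<rho>"]]] by simp
  from tendsto_diff[OF r_lim this]
  have "(\<lambda>K. r K - f K \<rho>) \<longlonglongrightarrow> q - d \<rho>" for \<rho> .
  from order_tendstoD(1)[OF this, of 0]
  have "\<forall>\<^sub>F K in sequentially. f K \<rho> < r K" if "prefix \<rho> \<sigma>" for \<rho>
    using less[OF that] by simp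
  then have "\<forall>\<^sub>F K in sequentially. \<forall>\<rho>\<in>set (prefixes \<sigma>). f K \<rho> < r K"
    by (intro eventually_ball_finite) auto
  moreover have "\<forall>\<^sub>F K in sequentially. r K > 1"
    using order_tendstoD(1)[OF r_lim d(3)] .
  moreover have "\<forall>\<^sub>F K in sequentially. K > 0"
    by (rule eventually_gt_at_top)
  ultimately have "\<forall>\<^sub>F K in sequentially. (\<forall>\<rho>\<in>set (prefixes \<sigma>). f K \<rho> < r K) \<and> r K > 1 \<and> K > 0"
    by eventually_elim blast
  from eventually_happens'[OF sequentially_bot this]
  obtain K where "\<forall>\<rho>\<in>set (prefixes \<sigma>). f K \<rho> < r K" and K: "r K > 1" "K > 0"
    by blast
  then have f_less: "f K \<rho> < r K" if "prefix \<rho> \<sigma>" for \<rho>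
    using that by simp
  have ecn: "ecn_martingale (f K)"
    unfolding f_def by (rule ecn_martingale_convex_combination[OF d(1) e K(2)])
  obtain n where n: "r K * K < 2 ^ n"
    using real_arch_pow[of 2] by auto
  let ?V = "hits (\<lambda>\<rho>. f K \<rho> \<ge> r K)"
  have "r K \<in> \<rat>" unfolding r_def using d(2) by simp
  then have "winning_open ?V"
    unfolding winning_open_iff using ecn K(1) by blast
  moreover have "X \<union> induced_test e n \<subseteq> ?V"
  proof -
    have nonneg: "0 \<le> (1 - 1 / real K)" "d \<rho> \<ge> 0" "e \<rho> \<ge> 0" for \<rho>
      using d(1) e K(2) by (auto simp: ecn_martingale_def martingale_def)
    have "f K \<rho> \<ge> r K" if "d \<rho> \<ge> q" for \<rho>
      unfolding f_def r_def
      using add_mono[OF mult_left_mono[OF that nonneg(1)], of 0 "1 / real K * e \<rho>"] nonneg(3)[of \<rho>]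
      by simp
    moreover have "f K \<rho> \<ge> r K" if "e \<rho> \<ge> 2 ^ n" for \<rho>
    proof -
      have "r K \<le> 2 ^ n / K" using n K(2) by (simp add: le_divide_eq)
      also have "\<dots> \<le> e \<rho> / K" using that by (simp add: divide_right_mono)
      also have "\<dots> \<le> f K \<rho>"
        using mult_nonneg_nonneg[OF nonneg(1) nonneg(2)] by (simp add: f_def)
      finally show ?thesis .
    qed
    ultimately show ?thesis
      unfolding X_eq induced_test_eq_hits hits_def by blast
  qed
  moreover have "measure \<mu> (above ?V \<sigma>) < 1"
  proof -
    have "measure \<mu> (above ?V \<sigma>) \<le> f K \<sigma> / r K"
      using K(1) ecn f_less by (intro Ville_above) (auto simp: ecn_martingale_def strict_prefix_def)
    also have "\<dots> < 1" using f_less[OF prefix_order.refl] K(1) by simp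
    finally show ?thesis .
  qed
  ultimately show ?thesis by blast
qed


section \<open>Enumerating the families of tests\<close>

lemma ex_listing: "countable F \<Longrightarrow> F \<noteq> {} \<Longrightarrow> \<exists>T :: nat \<Rightarrow> 'a. range T = F"
  using range_from_nat_into by metis

lemma countable_martin_loef_tests: "countable {t. martin_loef_test t}"
proof (rule countable_subset)
  show "{t. martin_loef_test t} \<subseteq>
      (\<lambda>f n. generated {\<sigma>. \<exists>s. f [n, s] = Suc (str_code \<sigma>)}) ` {f. recursive 2 f}"
  proof
    fix t assume "t \<in> {t. martin_loef_test t}"
    then obtain U f where "recursive 2 f" "\<And>n. t n = generated (U n)"
      and "\<And>n. U n = {\<sigma>. \<exists>s. f [n, s] = Suc (str_code \<sigma>)}"
      unfolding martin_loef_test_def uniformly_ce_open_def uniformly_ce_strings_def by blast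
    then show "t \<in> (\<lambda>f n. generated {\<sigma>. \<exists>s. f [n, s] = Suc (str_code \<sigma>)}) ` {f. recursive 2 f}"
      by (intro image_eqI[of _ _ f]) auto
  qed
  show "countable ((\<lambda>f n. generated {\<sigma>. \<exists>s. f [n, s] = Suc (str_code \<sigma>)}) ` {f. recursive 2 f})"
    by (intro countable_image countable_recursive)
qed

lemma countable_induced_tests: "countable {induced_test d | d. ecn_martingale d}"
proof (rule countable_subset)
  let ?m = "\<lambda>(a, c) \<sigma>. real (a [str_code \<sigma>]) / real (Suc (c [str_code \<sigma>]))"
  show "{induced_test d | d. ecn_martingale d} \<subseteq>
      (\<lambda>p. induced_test (?m p)) ` ({f. recursive 1 f} \<times> {f. recursive 1 f})"
  proof
    fix t assume "t \<in> {induced_test d | d. ecn_martingale d}"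
    then obtain d a c where t: "t = induced_test d" and ac: "recursive 1 a" "recursive 1 c"
      and d: "\<forall>\<sigma>. d \<sigma> = real (a [str_code \<sigma>]) / real (Suc (c [str_code \<sigma>]))"
      unfolding ecn_martingale_def exactly_computable_def by blast
    have "d = ?m (a, c)" using d by auto
    with t ac show "t \<in> (\<lambda>p. induced_test (?m p)) ` ({f. recursive 1 f} \<times> {f. recursive 1 f})"
      by blast
  qed
  show "countable ((\<lambda>p. induced_test (?m p)) ` ({f. recursive 1 f} \<times> {f. recursive 1 f}))"
    by (intro countable_image countable_SIGMA countable_recursive)
qed

lemma str_code_replicate_False: "Suc (str_code (replicate n False)) = 2 ^ n"
proof (induction n)
  case (Suc n)
  have "replicate (Suc n) False = replicate n False @ [False]"
    by (simp add: replicate_append_same)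
  then have "Suc (str_code (replicate (Suc n) False)) = 2 * Suc (str_code (replicate n False))"
    by simp
  then show ?case by (simp only: Suc.IH power_Suc)
qed simp

text \<open>
  A witness that there are Martin-Loef and Schnorr tests at all, without which neither family could be
  listed as a sequence.
\<close>

lemma schnorr_test_zero_cylinders: "schnorr_test (\<lambda>n. cylinder (replicate n False))"
proof -
  let ?T = "\<lambda>n. cylinder (replicate n False)"
  have meas: "measure \<mu> (?T n) = 1 / 2 ^ n" for n
    by (simp add: measure_cylinder)
  have "computable (\<lambda>p :: nat \<times> nat. 2 ^ fst p :: nat)"
    by (intro computable_intros)
  then obtain F where F: "recursive 2 F" "\<And>n s. F [n, s] = 2 ^ n"
    unfolding computable_nat2_iff by auto
  have "{replicate n False} = {\<sigma>. \<exists>s. F [n, s] = Suc (str_code \<sigma>)}" for n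
    unfolding F str_code_replicate_False[symmetric] by auto
  then have "uniformly_ce_strings (\<lambda>n. {replicate n False})"
    unfolding uniformly_ce_strings_def using F(1) by blast
  moreover have "prefix_free {replicate n False} \<and> ?T n = generated {replicate n False}" for n
    by (auto simp: prefix_free_def generated_def)
  ultimately have "uniformly_ce_open ?T"
    unfolding uniformly_ce_open_def by blast
  moreover have "test ?T"
    unfolding test_def
  proof (intro conjI allI open_cylinder)
    show "decseq ?T"
      by (auto simp: decseq_def cylinder_def)
    show "measure \<mu> (\<Inter>n. ?T n) = 0"
      using cylinder_measurable meas by (intro measure_INT_eq_0) auto
  qed
  ultimately show ?thesis
    by (simp add: schnorr_test_def martin_loef_test_def meas)
qed

lemma schnorr_open_schnorr_test:
  assumes "schnorr_test T"
  shows "schnorr_open (T n)"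
proof -
  have ce: "ce_open (T n)"
    using assms uniformly_ce_open_imp_ce_open unfolding schnorr_test_def martin_loef_test_def by blast
  have "computable (\<lambda>k::nat. 1::nat)" "computable (\<lambda>k::nat. 0::nat)" "computable (\<lambda>k::nat. 2 ^ n - 1 :: nat)"
    by (intro computable_intros)+
  then obtain A B C where "recursive 1 A" "recursive 1 B" "recursive 1 C"
    and "\<And>k. A [k] = 1" "\<And>k. B [k] = 0" "\<And>k. C [k] = 2 ^ n - 1"
    unfolding computable_nat1_iff by blast
  moreover from this have
    "\<forall>k. \<bar>1 / 2 ^ n - (real (A [k]) - real (B [k])) / real (Suc (C [k]))\<bar> \<le> 1 / 2 ^ k"
    by (simp add: of_nat_diff)
  ultimately have "computable_real (1 / 2 ^ n)"
    unfolding computable_real_def by blast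
  with ce show ?thesis
    using assms unfolding schnorr_open_def schnorr_test_def by simp
qed


section \<open>The three cases\<close>

lemma satisfies_martin_loef:
  "satisfies_P1_P2_P3 {U. ce_open U \<and> bounded_open U} {t. martin_loef_test t}"
  unfolding satisfies_P1_P2_P3_def
proof (intro conjI)
  show "\<forall>U\<in>{U. ce_open U \<and> bounded_open U}. bounded_open U" by simp
  show "\<forall>t\<in>{t. martin_loef_test t}. test t" by (simp add: martin_loef_test_def)
  show "\<exists>T :: nat \<Rightarrow> _. range T = {t. martin_loef_test t}"
    using schnorr_test_zero_cylinders
    by (intro ex_listing countable_martin_loef_tests) (auto simp: schnorr_test_def)
  show "P1 {U. ce_open U \<and> bounded_open U}"
    unfolding P1_def using ce_open_above bounded_open_iff by blast
  show "P2 {U. ce_open U \<and> bounded_open U}"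
    unfolding P2_def
  proof
    fix U assume "U \<in> {U. ce_open U \<and> bounded_open U}"
    then have U: "ce_open U" "measure \<mu> U < 1" by (auto simp: bounded_open_iff)
    then obtain V where "ce_open V" "measure \<mu> V < 1"
      and full: "\<forall>\<sigma>. measure \<mu> (above U \<sigma>) = 1 \<longrightarrow> cylinder \<sigma> \<subseteq> V"
      using ce_superset_of_density_points by blast
    with subset_if_contains_full_cylinders[OF U(1) full]
    show "\<exists>V\<in>{U. ce_open U \<and> bounded_open U}. U \<subseteq> V \<and>
        (\<forall>\<sigma>. measure \<mu> (above U \<sigma>) = 1 \<longrightarrow> cylinder \<sigma> \<subseteq> V)"
      by (auto simp: bounded_open_iff)
  qed
  show "\<forall>T. range T = {t. martin_loef_test t} \<longrightarrow> P3 {U. ce_open U \<and> bounded_open U} T"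
    unfolding P3_def
  proof (intro allI impI ballI)
    fix T U \<sigma> e
    assume "range T = {t. martin_loef_test t}" "U \<in> {U. ce_open U \<and> bounded_open U}"
      and above: "measure \<mu> (above U \<sigma>) < 1"
    then have T: "martin_loef_test (T e)" and U: "ce_open U" "measure \<mu> U < 1"
      by (auto simp: bounded_open_iff)
    have ce: "ce_open (T e n)" for n
      using T uniformly_ce_open_imp_ce_open unfolding martin_loef_test_def by blast
    obtain n where "measure \<mu> (U \<union> T e n) < 1" "measure \<mu> (above (U \<union> T e n) \<sigma>) < 1"
      using small_enough_test_component[OF ce_open_measurable[OF U(1)] U(2) above, of "T e"]
        ce_open_measurable[OF ce] T unfolding martin_loef_test_def by blast
    with ce_open_Un[OF U(1) ce]
    show "\<exists>n. \<exists>V\<in>{U. ce_open U \<and> bounded_open U}. U \<union> T e n \<subseteq> V \<and> measure \<mu> (above V \<sigma>) < 1"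
      by (intro exI[of _ n] bexI[of _ "U \<union> T e n"]) (auto simp: bounded_open_iff)
  qed
qed

lemma satisfies_schnorr:
  "satisfies_P1_P2_P3 {U. schnorr_open U \<and> bounded_open U} {t. schnorr_test t}"
  unfolding satisfies_P1_P2_P3_def
proof (intro conjI)
  have bounded_iff: "bounded_open U \<longleftrightarrow> measure \<mu> U < 1" if "schnorr_open U" for U
    using that by (simp add: schnorr_open_def bounded_open_iff)
  show "\<forall>U\<in>{U. schnorr_open U \<and> bounded_open U}. bounded_open U" by simp
  show "\<forall>t\<in>{t. schnorr_test t}. test t" by (simp add: schnorr_test_def martin_loef_test_def)
  show "\<exists>T :: nat \<Rightarrow> _. range T = {t. schnorr_test t}"
    using schnorr_test_zero_cylinders
    by (intro ex_listing countable_subset[OF _ countable_martin_loef_tests]) (auto simp: schnorr_test_def)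
  show "P1 {U. schnorr_open U \<and> bounded_open U}"
    unfolding P1_def using schnorr_open_above bounded_iff by blast
  show "P2 {U. schnorr_open U \<and> bounded_open U}"
    unfolding P2_def
  proof
    fix U assume "U \<in> {U. schnorr_open U \<and> bounded_open U}"
    then have U: "schnorr_open U" "measure \<mu> U < 1" by (auto simp: bounded_iff)
    then obtain V where "schnorr_open V" "measure \<mu> V < 1"
      and full: "\<forall>\<sigma>. measure \<mu> (above U \<sigma>) = 1 \<longrightarrow> cylinder \<sigma> \<subseteq> V"
      using schnorr_superset_of_density_points by blast
    moreover have "U \<subseteq> V"
      using U(1) full by (intro subset_if_contains_full_cylinders) (simp_all add: schnorr_open_def)
    ultimately show "\<exists>V\<in>{U. schnorr_open U \<and> bounded_open U}. U \<subseteq> V \<and>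
        (\<forall>\<sigma>. measure \<mu> (above U \<sigma>) = 1 \<longrightarrow> cylinder \<sigma> \<subseteq> V)"
      by (auto simp: bounded_iff)
  qed
  show "\<forall>T. range T = {t. schnorr_test t} \<longrightarrow> P3 {U. schnorr_open U \<and> bounded_open U} T"
    unfolding P3_def
  proof (intro allI impI ballI)
    fix T U \<sigma> e
    assume "range T = {t. schnorr_test t}" "U \<in> {U. schnorr_open U \<and> bounded_open U}"
      and above: "measure \<mu> (above U \<sigma>) < 1"
    then have T: "schnorr_test (T e)" and U: "schnorr_open U" "measure \<mu> U < 1"
      by (auto simp: bounded_iff)
    have sch: "schnorr_open (T e n)" for n
      by (rule schnorr_open_schnorr_test[OF T])
    have sets: "X \<in> sets \<mu>" if "schnorr_open X" for X
      using that by (simp add: schnorr_open_def ce_open_measurable)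
    obtain n where "measure \<mu> (U \<union> T e n) < 1" "measure \<mu> (above (U \<union> T e n) \<sigma>) < 1"
      using small_enough_test_component[OF sets[OF U(1)] U(2) above, of "T e"]
        sets[OF sch] T unfolding schnorr_test_def by (metis order_refl)
    with schnorr_open_Un[OF U(1) sch]
    show "\<exists>n. \<exists>V\<in>{U. schnorr_open U \<and> bounded_open U}. U \<union> T e n \<subseteq> V \<and> measure \<mu> (above V \<sigma>) < 1"
      by (intro exI[of _ n] bexI[of _ "U \<union> T e n"]) (auto simp: bounded_iff)
  qed
qed

lemma satisfies_computable_randomness:
  "satisfies_P1_P2_P3 {U. winning_open U} {induced_test d | d. ecn_martingale d}"
  unfolding satisfies_P1_P2_P3_def
proof (intro conjI)
  show "\<forall>U\<in>{U. winning_open U}. bounded_open U"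
    using winning_open_bounded by simp
  show "\<forall>t\<in>{induced_test d | d. ecn_martingale d}. test t"
    using test_induced_test by auto
  show "\<exists>T :: nat \<Rightarrow> _. range T = {induced_test d | d. ecn_martingale d}"
    using ecn_martingale_const by (intro ex_listing countable_induced_tests) blast
  show "P1 {U. winning_open U}"
    unfolding P1_def using winning_open_above by blast
  show "P2 {U. winning_open U}"
    unfolding P2_def using winning_open_contains_full_cylinders by blast
  show "\<forall>T. range T = {induced_test d | d. ecn_martingale d} \<longrightarrow> P3 {U. winning_open U} T"
    unfolding P3_def
  proof (intro allI impI ballI)
    fix T U \<sigma> e
    assume range: "range T = {induced_test d | d. ecn_martingale d}"
      and "U \<in> {U. winning_open U}" and above: "measure \<mu> (above U \<sigma>) < 1"
    then have U: "winning_open U" by simp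
    have "T e \<in> {induced_test d | d. ecn_martingale d}" unfolding range[symmetric] by simp
    then obtain d where d: "ecn_martingale d" and T: "T e = induced_test d" by blast
    show "\<exists>n. \<exists>V\<in>{U. winning_open U}. U \<union> T e n \<subseteq> V \<and> measure \<mu> (above V \<sigma>) < 1"
      using winning_open_Un_induced_test[OF U above d] unfolding T by blast
  qed
qed

theorem proposition3p1:
  shows "satisfies_P1_P2_P3 {U. ce_open U \<and> bounded_open U} {t. martin_loef_test t} \<and>
    satisfies_P1_P2_P3 {U. winning_open U} {induced_test d | d. ecn_martingale d} \<and>
    satisfies_P1_P2_P3 {U. schnorr_open U \<and> bounded_open U} {t. schnorr_test t}"
  using satisfies_martin_loef satisfies_computable_randomness satisfies_schnorr by blast

end
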